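(* Let $\Gamma$ be a method specification, let $\mathcal{L}_1,\mathcal{L}_2$ be libraries and $\mathcal{C}$ a client, and let $I_1,I_2,I\subseteq\Sigma$. Suppose $\mathcal{L}_1:\Gamma$, $\mathcal{L}_2:\Gamma$ and $\Gamma\vdash\mathcal{C}$ are safe for $I_1$, $I_2$ and $I$ respectively, and $(\mathcal{L}_1:\Gamma,I_1)\sqsubseteq(\mathcal{L}_2:\Gamma,I_2)$. Then $\mathcal{C}(\mathcal{L}_1)$ and $\mathcal{C}(\mathcal{L}_2)$ are safe for $I*I_1$ and $I*I_2$ respectively, and $$\forall(\sigma_1,\tau_1)\in[\![\mathcal{C}(\mathcal{L}_1),I*I_1]\!].\ \exists(\sigma_2,\tau_2)\in[\![\mathcal{C}(\mathcal{L}_2),I*I_2]\!].\ \mathsf{client}(\tau_1)=\mathsf{client}(\tau_2).$$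
   Context: Separation algebra. $\Sigma$ is a set with a partial binary operation $*$ that is commutative and associative (in the sense that both sides are defined and equal, or both undefined) and cancellative (for each $\sigma$, the partial map $\sigma*\cdot$ is injective), with a unit $e$. Write $(\sigma_1*\sigma_2)\downarrow$ when defined. For sets, $p*q=\{\sigma_1*\sigma_2\mid\sigma_1\in p,\sigma_2\in q,(\sigma_1*\sigma_2)\downarrow\}$. $\sigma_2\setminus\sigma_1$ is the unique $\sigma$ with $\sigma_2=\sigma*\sigma_1$ (undefined if none). The footprint of $\sigma$ is $\delta(\sigma)=\{\sigma'\mid\forall\sigma''.\,(\sigma'*\sigma'')\downarrow\iff(\sigma*\sigma'')\downarrow\}$. For footprints, $\delta(\sigma_1)\circ\delta(\sigma_2)=\delta(\sigma_1*\sigma_2)$ if $\sigma_1*\sigma_2$ is defined, undefined otherwise. Standing assumption: $*$ is cancellative on footprints, i.e. whenever $\sigma_1*\sigma_2$ and $\sigma_1'*\sigma_2'$ are defined, $\delta(\sigma_1*\sigma_2)=\delta(\sigma_1'*\sigma_2')$ and $\delta(\sigma_1)=\delta(\sigma_1')$ imply $\delta(\sigma_2)=\delta(\sigma_2')$. Footprint subtraction: $l_2\mathbin{\backslash\!\backslash}l_1=\delta(\sigma)$ if $l_1=\delta(\sigma_1)$, $l_2=\delta(\sigma_2)$, $\sigma_2=\sigma_1*\sigma$ for some states, undefined otherwise; $l_1\preceq l_2$ iff $l_2\mathbin{\backslash\!\backslash}l_1$ is defined. Histories. Fix sets ThreadID and Method. An interface action is $(t,\mathsf{call}\ m(\sigma))$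 or $(t,\mathsf{ret}\ m(\sigma))$ ($\sigma$ is the state transferred). A history is a finite sequence $H$ of interface actions whose projection to each thread alternates calls and returns of matching methods, starting with a call. Define the partial map $[\![H]\!]^\sharp$ on footprints: $[\![\varepsilon]\!]^\sharp l=l$; $[\![H\psi]\!]^\sharp l=([\![H]\!]^\sharp l)\circ\delta(\sigma)$ if $\psi$ is a call carrying $\sigma$, and $([\![H]\!]^\sharp l)\mathbin{\backslash\!\backslash}\delta(\sigma)$ if $\psi$ is a return carrying $\sigma$ (undefined whenever anything is undefined). $H$ is balanced from $l$ if $[\![H]\!]^\sharp l$ is defined. $H\sqsubseteq H'$ iff there is a bijection $\rho:\{1..|H|\}\to\{1..|H'|\}$ with $H(i)=H'(\rho(i))$ for all $i$ and, for all $i<j$, if $H(i),H(j)$ are by the same thread, or $H(i)$ is a return and $H(j)$ is a call, then $\rho(i)<\rho(j)$. For pairs $(l,H)$, $(l',H')$ with $H$ balanced from $l$ and $H'$ from $l'$: $(l,H)\sqsubseteq(l',H')$ iff $l'\preceq l$ and $H\sqsubseteq H'$. For sets $\mathcal{H}_1,\mathcal{H}_2$ of such pairs, $\mathcal{H}_1\sqsubseteq\mathcal{H}_2$ iff every element of $\mathcal{H}_1$ is $\sqsubseteq$ some element of $\mathcal{H}_2$. Primitive commands. Each primitive command $c$ and thread $t$ has a transformer $f^t_c:\Sigma\to\mathcal{P}(\Sigma)\cup\{\top\}$ ($\top$ = fault) satisfying Footprint Preservation ($\sigma'\in f^t_c(\sigma)\Rightarrow\delta(\sigma')=\delta(\sigma)$)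 and Strong Locality (if $(\sigma_1*\sigma_2)\downarrow$ and $f^t_c(\sigma_1)\ne\top$ then $f^t_c(\sigma_1*\sigma_2)=f^t_c(\sigma_1)*\{\sigma_2\}$). Programs. Commands $C::=c\mid m\mid C;C\mid C+C\mid C^*$ ($m$ a method call). A library is $\mathcal{L}=\{m=C_m\mid m\in M\}$ with method bodies containing no method calls; a client is $\mathcal{C}=\mathsf{let}\ [-]\ \mathsf{in}\ C_1\|\cdots\|C_n$; $\mathcal{C}(\mathcal{L})$ is the complete program $\mathsf{let}\ \mathcal{L}\ \mathsf{in}\ C_1\|\cdots\|C_n$. A predicate $r\subseteq\Sigma$ is precise if every $\sigma$ has at most one $\sigma_1\in r$ with $\sigma=\sigma_1*\sigma_2$ for some $\sigma_2$; then $\sigma\setminus r$ denotes that $\sigma_2$. A parameterised predicate $p$ maps each thread $t$ to a predicate $p_t$. A method specification $\Gamma$ is a set of triples $\{p\}\,m\,\{q\}$ (at most one per method) with $p,q$ precise parameterised predicates; $p_t$ describes the state transferred from client to library when $t$ calls $m$, $q_t$ that transferred back at the return. Specified programs: $\mathcal{L}:\Gamma$ and $\Gamma\vdash\mathcal{C}$. Traces. Actions are $(t,c)$, $(t,\mathsf{call}\ m)$, $(t,\mathsf{ret}\ m)$ and annotated interface actions. A trace is a finite sequence of actions whose projection to each thread's calls and returns alternates over matching methods starting with a call. In a trace $\tau$, an action $\tau(i)=(t,c)$ is a library action if some earlier $(t,\mathsf{call}\,\_)$ has no $(t,\mathsf{ret}\,\_)$ between it and $i$; otherwise it is a client action. $\mathsf{client}(\tau)$,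 $\mathsf{lib}(\tau)$, $\mathsf{history}(\tau)$ are the projections of $\tau$ to client actions plus calls/returns, library actions plus calls/returns, and calls/returns only; $\mathsf{ground}(\tau)$ erases state annotations of interface actions. Trace sets. For thread $t$ and $\eta$ mapping (method, thread) to trace sets: $[c]_t\eta=\{(t,c)\}$; $[C_1+C_2]_t\eta=[C_1]_t\eta\cup[C_2]_t\eta$; $[C^*]_t\eta=([C]_t\eta)^*$; $[m]_t\eta=\{(t,\mathsf{call}\,m)\,\tau\,(t,\mathsf{ret}\,m)\mid\tau\in\eta(m,t)\}$; $[C_1;C_2]_t\eta$ = concatenations; $[C_1\|\cdots\|C_n]\eta$ = traces all of whose actions are by threads in $\{1..n\}$ with projection to each $t$ in $[C_t]_t\eta$. The trace set of $\mathcal{C}(\mathcal{L})$ is the prefix closure of $[C_1\|\cdots\|C_n]\eta$ with $\eta(m,t)=[C_m]_t$; of $\Gamma\vdash\mathcal{C}$, the same with $\eta(m,t)=\{\varepsilon\}$; of $\mathcal{L}:\Gamma$ with methods $m_1,\dots,m_j$, the prefix closure of $\bigcup_{k\ge1}[C_{mgc}\|\cdots\|C_{mgc}]\eta$ ($k$ copies, $C_{mgc}=(m_1+\cdots+m_j)^*$, $\eta(m,t)=[C_m]_t$). Evaluation. An action $\varphi$ from state $\sigma$ yields a set of (state, annotated action) pairs or $\top$. $(t,c)$: $\top$ if $f^t_c(\sigma)=\top$, else $\{(\sigma',(t,c))\mid\sigma'\in f^t_c(\sigma)\}$. In a complete program, and for methods without a specification, calls and returns give $\{(\sigma,\varphi)\}$.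 Library-local ($\mathcal{L}:\Gamma$, $\{p\}m\{q\}\in\Gamma$): $(t,\mathsf{call}\,m)$ gives $\{(\sigma*\sigma_p,(t,\mathsf{call}\,m(\sigma_p)))\mid\sigma_p\in p_t,(\sigma*\sigma_p)\downarrow\}$; $(t,\mathsf{ret}\,m)$ gives $\top$ if $\sigma\setminus q_t$ is undefined, else $\{(\sigma\setminus q_t,(t,\mathsf{ret}\,m(\sigma_q)))\}$ where $\sigma_q\in q_t$ is the unique substate. Client-local ($\Gamma\vdash\mathcal{C}$): a call gives $\top$ if $\sigma\setminus p_t$ is undefined, else $\{(\sigma\setminus p_t,(t,\mathsf{call}\,m(\sigma_p)))\}$ with $\sigma_p\in p_t$ the unique substate; a return gives $\{(\sigma*\sigma_q,(t,\mathsf{ret}\,m(\sigma_q)))\mid\sigma_q\in q_t,(\sigma*\sigma_q)\downarrow\}$. A trace is evaluated step by step: $\varepsilon$ gives $\{(\sigma,\varepsilon)\}$; $\tau\varphi$ gives $\top$ if $\tau$ gives $\top$ or $\varphi$ gives $\top$ from some reachable state, else all $(\sigma'',\tau'\varphi')$ with $(\sigma',\tau')$ from $\tau$ and $(\sigma'',\varphi')$ from $\varphi$ at $\sigma'$. The denotation $[\![P]\!]\sigma$ is $\top$ if some trace of $P$'s trace set evaluates to $\top$ from $\sigma$, and otherwise the set of annotated traces $\tau'$ with $(\_,\tau')$ obtained from some trace. $P$ is safe at $\sigma$ if $[\![P]\!]\sigma\ne\top$, safe for $I$ if safe at all $\sigma\in I$. $[\![P,I]\!]=\{(\sigma,\tau)\mid\sigma\in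 I,\tau\in[\![P]\!]\sigma\}$. $\mathsf{interf}(\mathcal{L}:\Gamma,I)=\{(\delta(\sigma_0),\mathsf{history}(\tau))\mid(\sigma_0,\tau)\in[\![\mathcal{L}:\Gamma,I]\!]\}$; $(\mathcal{L}_1:\Gamma,I_1)\sqsubseteq(\mathcal{L}_2:\Gamma,I_2)$ iff $\mathsf{interf}(\mathcal{L}_1:\Gamma,I_1)\sqsubseteq\mathsf{interf}(\mathcal{L}_2:\Gamma,I_2)$. *)

theory Defs
  imports Main
begin

section \<open>Separation algebras and footprints\<close>

definition fp_of :: "('s \<Rightarrow> 's \<Rightarrow> 's option) \<Rightarrow> 's \<Rightarrow> 's set" where
  "fp_of st \<sigma> = {\<sigma>'. \<forall>\<sigma>''. st \<sigma>' \<sigma>'' \<noteq> None \<longleftrightarrow> st \<sigma> \<sigma>'' \<noteq> None}"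

text \<open>
  The partial operation is an option-valued function. The last axiom is the standing assumption
  that the operation is cancellative on footprints.
\<close>

class separation_algebra =
  fixes sep :: "'a \<Rightarrow> 'a \<Rightarrow> 'a option"  (infixl "\<star>" 70)
    and sep_unit :: 'a
  assumes sep_commute: "x \<star> y = y \<star> x"
    and sep_assoc: "Option.bind (x \<star> y) (\<lambda>u. u \<star> z) = Option.bind (y \<star> z) (\<lambda>v. x \<star> v)"
    and sep_cancel: "x \<star> y = Some u \<Longrightarrow> x \<star> z = Some u \<Longrightarrow> y = z"
    and sep_unit: "sep_unit \<star> x = Some x"
    and sep_fp_cancel:
      "x \<star> y = Some u \<Longrightarrow> x' \<star> y' = Some u' \<Longrightarrow>
       fp_of (\<star>) u = fp_of (\<star>) u' \<Longrightarrow> fp_of (\<star>) x = fp_of (\<star>) x' \<Longrightarrow>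
       fp_of (\<star>) y = fp_of (\<star>) y'"

definition fp :: "'s::separation_algebra \<Rightarrow> 's set"  ("\<delta>") where
  "\<delta> = fp_of (\<star>)"

definition sep_set :: "'s::separation_algebra set \<Rightarrow> 's set \<Rightarrow> 's set"  (infixl "\<star>\<^sub>s" 70) where
  "p \<star>\<^sub>s q = {\<sigma>. \<exists>\<sigma>1\<in>p. \<exists>\<sigma>2\<in>q. \<sigma>1 \<star> \<sigma>2 = Some \<sigma>}"

text \<open>
  Both operations on footprints are independent of the chosen representatives, so the definite
  descriptions below are proper.
\<close>

definition fp_comp :: "'s::separation_algebra set \<Rightarrow> 's set \<Rightarrow> 's set option" where
  "fp_comp l1 l2 =
    (if \<exists>\<sigma>1 \<sigma>2 \<sigma>. l1 = \<delta> \<sigma>1 \<and> l2 = \<delta> \<sigma>2 \<and> \<sigma>1 \<star> \<sigma>2 = Some \<sigma>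
     then Some (THE l. \<exists>\<sigma>1 \<sigma>2 \<sigma>. l1 = \<delta> \<sigma>1 \<and> l2 = \<delta> \<sigma>2 \<and> \<sigma>1 \<star> \<sigma>2 = Some \<sigma> \<and> l = \<delta> \<sigma>)
     else None)"

definition fp_sub :: "'s::separation_algebra set \<Rightarrow> 's set \<Rightarrow> 's set option" where
  "fp_sub l2 l1 =
    (if \<exists>\<sigma>1 \<sigma>2 \<sigma>. l1 = \<delta> \<sigma>1 \<and> l2 = \<delta> \<sigma>2 \<and> \<sigma>1 \<star> \<sigma> = Some \<sigma>2
     then Some (THE l. \<exists>\<sigma>1 \<sigma>2 \<sigma>. l1 = \<delta> \<sigma>1 \<and> l2 = \<delta> \<sigma>2 \<and> \<sigma>1 \<star> \<sigma> = Some \<sigma>2 \<and> l = \<delta> \<sigma>)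
     else None)"

definition fp_le :: "'s::separation_algebra set \<Rightarrow> 's set \<Rightarrow> bool"  (infix "\<preceq>" 50) where
  "l1 \<preceq> l2 \<longleftrightarrow> fp_sub l2 l1 \<noteq> None"

definition precise :: "'s::separation_algebra set \<Rightarrow> bool" where
  "precise r \<longleftrightarrow>
    (\<forall>\<sigma> \<sigma>1 \<sigma>2 \<sigma>1' \<sigma>2'. \<sigma>1 \<in> r \<longrightarrow> \<sigma>1' \<in> r \<longrightarrow>
       \<sigma>1 \<star> \<sigma>2 = Some \<sigma> \<longrightarrow> \<sigma>1' \<star> \<sigma>2' = Some \<sigma> \<longrightarrow> \<sigma>1 = \<sigma>1')"

text \<open>
  For precise \<open>r\<close>, \<open>split_pred \<sigma> r\<close> is the pair of the unique substate of \<open>\<sigma>\<close> in \<open>r\<close> and the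
  remainder of \<open>\<sigma>\<close> (i.e. \<open>\<sigma>\<close> minus \<open>r\<close>); it is \<open>None\<close> if there is no such substate.
\<close>

definition split_pred :: "'s::separation_algebra \<Rightarrow> 's set \<Rightarrow> ('s \<times> 's) option" where
  "split_pred \<sigma> r =
    (if \<exists>\<sigma>1 \<sigma>2. \<sigma>1 \<in> r \<and> \<sigma>1 \<star> \<sigma>2 = Some \<sigma>
     then Some (THE (\<sigma>1, \<sigma>2). \<sigma>1 \<in> r \<and> \<sigma>1 \<star> \<sigma>2 = Some \<sigma>)
     else None)"

section \<open>Actions, traces and histories\<close>

text \<open>Parallel compositions are indexed by threads \<open>1..n\<close>, so thread identifiers are numbers.\<close>

type_synonym tid = nat

text \<open>
  The annotation of an interface action is \<open>Some \<sigma>\<close> if it carries the transferred state \<open>\<sigma>\<close>, and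
  \<open>None\<close> for the bare actions \<open>(t, call m)\<close> and \<open>(t, ret m)\<close>.
\<close>

datatype ('c, 'm, 's) act = Exec 'c | Call 'm "'s option" | Ret 'm "'s option"

type_synonym ('c, 'm, 's) action = "tid \<times> ('c, 'm, 's) act"
type_synonym ('c, 'm, 's) trace = "('c, 'm, 's) action list"

definition is_exec :: "('c, 'm, 's) action \<Rightarrow> bool" where
  "is_exec \<phi> \<longleftrightarrow> (\<exists>t c. \<phi> = (t, Exec c))"

definition is_call :: "('c, 'm, 's) action \<Rightarrow> bool" where
  "is_call \<phi> \<longleftrightarrow> (\<exists>t m a. \<phi> = (t, Call m a))"

definition is_ret :: "('c, 'm, 's) action \<Rightarrow> bool" where
  "is_ret \<phi> \<longleftrightarrow> (\<exists>t m a. \<phi> = (t, Ret m a))"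

definition library_action :: "('c, 'm, 's) trace \<Rightarrow> nat \<Rightarrow> bool" where
  "library_action \<tau> i \<longleftrightarrow> i < length \<tau> \<and> is_exec (\<tau> ! i) \<and>
    (\<exists>j<i. fst (\<tau> ! j) = fst (\<tau> ! i) \<and> is_call (\<tau> ! j) \<and>
       (\<forall>k. j < k \<and> k < i \<longrightarrow> \<not> (fst (\<tau> ! k) = fst (\<tau> ! i) \<and> is_ret (\<tau> ! k))))"

definition client_action :: "('c, 'm, 's) trace \<Rightarrow> nat \<Rightarrow> bool" where
  "client_action \<tau> i \<longleftrightarrow> i < length \<tau> \<and> is_exec (\<tau> ! i) \<and> \<not> library_action \<tau> i"

definition client :: "('c, 'm, 's) trace \<Rightarrow> ('c, 'm, 's) trace" where
  "client \<tau> = nths \<tau> {i. client_action \<tau> i \<or> is_call (\<tau> ! i) \<or> is_ret (\<tau> ! i)}"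

definition history :: "('c, 'm, 's) trace \<Rightarrow> ('c, 'm, 's) trace" where
  "history \<tau> = filter (\<lambda>\<phi>. is_call \<phi> \<or> is_ret \<phi>) \<tau>"

text \<open>
  A method without a specification transfers no state. Its calls and returns stay unannotated and
  leave the footprint unchanged.
\<close>

fun fp_step :: "'s::separation_algebra set \<Rightarrow> ('c, 'm, 's) action \<Rightarrow> 's set option" where
  "fp_step l (t, Call m (Some \<sigma>)) = fp_comp l (\<delta> \<sigma>)"
| "fp_step l (t, Ret m (Some \<sigma>)) = fp_sub l (\<delta> \<sigma>)"
| "fp_step l _ = Some l"

definition hist_fp :: "('c, 'm, 's::separation_algebra) trace \<Rightarrow> 's set \<Rightarrow> 's set option" where
  "hist_fp H l = foldl (\<lambda>x \<psi>. Option.bind x (\<lambda>l'. fp_step l' \<psi>)) (Some l) H"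

definition balanced :: "'s::separation_algebra set \<Rightarrow> ('c, 'm, 's) trace \<Rightarrow> bool" where
  "balanced l H \<longleftrightarrow> hist_fp H l \<noteq> None"

definition hist_le :: "('c, 'm, 's) trace \<Rightarrow> ('c, 'm, 's) trace \<Rightarrow> bool" where
  "hist_le H H' \<longleftrightarrow> (\<exists>\<rho>. bij_betw \<rho> {..<length H} {..<length H'} \<and>
     (\<forall>i<length H. H ! i = H' ! \<rho> i) \<and>
     (\<forall>i j. i < j \<and> j < length H \<and>
        (fst (H ! i) = fst (H ! j) \<or> is_ret (H ! i) \<and> is_call (H ! j)) \<longrightarrow> \<rho> i < \<rho> j))"

definition interf_pair_le ::
    "'s::separation_algebra set \<times> ('c, 'm, 's) trace \<Rightarrow> 's set \<times> ('c, 'm, 's) trace \<Rightarrow> bool" where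
  "interf_pair_le = (\<lambda>(l, H) (l', H'). balanced l H \<and> balanced l' H' \<and> l' \<preceq> l \<and> hist_le H H')"

definition interf_le ::
    "('s::separation_algebra set \<times> ('c, 'm, 's) trace) set \<Rightarrow>
     ('s set \<times> ('c, 'm, 's) trace) set \<Rightarrow> bool" where
  "interf_le A B \<longleftrightarrow> (\<forall>x\<in>A. \<exists>y\<in>B. interf_pair_le x y)"

section \<open>Primitive commands\<close>

datatype 'a faulting = Fault | Outcomes "'a set"

type_synonym ('c, 's) transformer = "tid \<Rightarrow> 'c \<Rightarrow> 's \<Rightarrow> 's faulting"

definition footprint_preserving :: "('c, 's::separation_algebra) transformer \<Rightarrow> bool" where
  "footprint_preserving f \<longleftrightarrow>
    (\<forall>t c \<sigma> A \<sigma>'. f t c \<sigma> = Outcomes A \<longrightarrow> \<sigma>' \<in> A \<longrightarrow> \<delta> \<sigma>' = \<delta> \<sigma>)"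

definition strongly_local :: "('c, 's::separation_algebra) transformer \<Rightarrow> bool" where
  "strongly_local f \<longleftrightarrow>
    (\<forall>t c \<sigma>1 \<sigma>2 \<sigma> A. \<sigma>1 \<star> \<sigma>2 = Some \<sigma> \<longrightarrow> f t c \<sigma>1 = Outcomes A \<longrightarrow>
       f t c \<sigma> = Outcomes (A \<star>\<^sub>s {\<sigma>2}))"

section \<open>Programs\<close>

datatype ('c, 'm) cmd =
    Prim 'c
  | Meth 'm
  | Seq "('c, 'm) cmd" "('c, 'm) cmd"
  | Choice "('c, 'm) cmd" "('c, 'm) cmd"
  | Iter "('c, 'm) cmd"

fun methods_of :: "('c, 'm) cmd \<Rightarrow> 'm set" where
  "methods_of (Prim c) = {}"
| "methods_of (Meth m) = {m}"
| "methods_of (Seq C1 C2) = methods_of C1 \<union> methods_of C2"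
| "methods_of (Choice C1 C2) = methods_of C1 \<union> methods_of C2"
| "methods_of (Iter C) = methods_of C"

type_synonym ('c, 'm) library = "'m \<Rightarrow> ('c, 'm) cmd option"
type_synonym ('c, 'm) client = "('c, 'm) cmd list"
type_synonym ('m, 's) spec = "'m \<Rightarrow> ((tid \<Rightarrow> 's set) \<times> (tid \<Rightarrow> 's set)) option"

definition wf_library :: "('c, 'm) library \<Rightarrow> bool" where
  "wf_library L \<longleftrightarrow> (\<forall>C\<in>ran L. methods_of C = {})"

definition wf_spec :: "('m, 's::separation_algebra) spec \<Rightarrow> bool" where
  "wf_spec \<Gamma> \<longleftrightarrow> (\<forall>m p q t. \<Gamma> m = Some (p, q) \<longrightarrow> precise (p t) \<and> precise (q t))"

text \<open>Plugging \<open>L\<close> into \<open>Cs\<close> yields a complete program if \<open>L\<close> implements all methods called.\<close>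

definition complete_for :: "('c, 'm) client \<Rightarrow> ('c, 'm) library \<Rightarrow> bool" where
  "complete_for Cs L \<longleftrightarrow> (\<forall>C\<in>set Cs. methods_of C \<subseteq> dom L)"

datatype ('c, 'm, 's) program =
    Complete "('c, 'm) client" "('c, 'm) library"
  | SpecLib "('c, 'm) library" "('m, 's) spec"
  | SpecClient "('m, 's) spec" "('c, 'm) client"

section \<open>Trace sets\<close>

type_synonym ('c, 'm, 's) method_env = "'m \<Rightarrow> tid \<Rightarrow> ('c, 'm, 's) trace set"

definition iter_traces :: "'a list set \<Rightarrow> 'a list set" where
  "iter_traces A = {concat ts | ts. set ts \<subseteq> A}"

fun cmd_traces :: "('c, 'm, 's) method_env \<Rightarrow> tid \<Rightarrow> ('c, 'm) cmd \<Rightarrow> ('c, 'm, 's) trace set" where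
  "cmd_traces \<eta> t (Prim c) = {[(t, Exec c)]}"
| "cmd_traces \<eta> t (Meth m) = {(t, Call m None) # \<tau> @ [(t, Ret m None)] | \<tau>. \<tau> \<in> \<eta> m t}"
| "cmd_traces \<eta> t (Seq C1 C2) =
     {\<tau>1 @ \<tau>2 | \<tau>1 \<tau>2. \<tau>1 \<in> cmd_traces \<eta> t C1 \<and> \<tau>2 \<in> cmd_traces \<eta> t C2}"
| "cmd_traces \<eta> t (Choice C1 C2) = cmd_traces \<eta> t C1 \<union> cmd_traces \<eta> t C2"
| "cmd_traces \<eta> t (Iter C) = iter_traces (cmd_traces \<eta> t C)"

definition par_traces ::
    "nat \<Rightarrow> (tid \<Rightarrow> ('c, 'm, 's) trace set) \<Rightarrow> ('c, 'm, 's) trace set" where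
  "par_traces n S = {\<tau>. (\<forall>\<phi>\<in>set \<tau>. fst \<phi> \<in> {1..n}) \<and>
     (\<forall>t\<in>{1..n}. filter (\<lambda>\<phi>. fst \<phi> = t) \<tau> \<in> S t)}"

definition prefix_closure :: "'a list set \<Rightarrow> 'a list set" where
  "prefix_closure T = {\<tau>. \<exists>\<tau>'. \<tau> @ \<tau>' \<in> T}"

definition client_traces ::
    "('c, 'm, 's) method_env \<Rightarrow> ('c, 'm) client \<Rightarrow> ('c, 'm, 's) trace set" where
  "client_traces \<eta> Cs = par_traces (length Cs) (\<lambda>t. cmd_traces \<eta> t (Cs ! (t - 1)))"

text \<open>
  Bodies of well-formed libraries contain no method calls, so the environment used for evaluating
  them is irrelevant.
\<close>

definition lib_env :: "('c, 'm) library \<Rightarrow> ('c, 'm, 's) method_env" where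
  "lib_env L m t = (case L m of None \<Rightarrow> {} | Some C \<Rightarrow> cmd_traces (\<lambda>_ _. {}) t C)"

text \<open>
  The traces of the most general client \<open>(m\<^sub>1 + \<dots> + m\<^sub>j)\<^sup>*\<close> of \<open>L\<close>, written as a union over the
  methods of \<open>L\<close> so as to be independent of their enumeration and to cover \<open>j = 0\<close>.
\<close>

definition mgc_traces :: "('c, 'm) library \<Rightarrow> tid \<Rightarrow> ('c, 'm, 's) trace set" where
  "mgc_traces L t = iter_traces (\<Union>m\<in>dom L. cmd_traces (lib_env L) t (Meth m))"

lemma mgc_traces_eq_cmd_traces:
  fixes L :: "('c, 'm) library"
  assumes "dom L = set (m # ms)"
  shows "(mgc_traces L t :: ('c, 'm, 's) trace set) =
    cmd_traces (lib_env L) t (Iter (foldr (\<lambda>m C. Choice (Meth m) C) ms (Meth m)))"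
proof -
  have "cmd_traces \<eta> t (foldr (\<lambda>m C. Choice (Meth m) C) ms (Meth m)) =
      (\<Union>m\<in>set (m # ms). cmd_traces \<eta> t (Meth m))" for \<eta> :: "('c, 'm, 's) method_env"
    by (induction ms) auto
  then show ?thesis
    unfolding mgc_traces_def assms by simp
qed

fun traces :: "('c, 'm, 's) program \<Rightarrow> ('c, 'm, 's) trace set" where
  "traces (Complete Cs L) = prefix_closure (client_traces (lib_env L) Cs)"
| "traces (SpecClient \<Gamma> Cs) = prefix_closure (client_traces (\<lambda>_ _. {[]}) Cs)"
| "traces (SpecLib L \<Gamma>) = prefix_closure (\<Union>k\<in>{1..}. par_traces k (mgc_traces L))"

section \<open>Evaluation\<close>

fun step ::
    "('c, 's::separation_algebra) transformer \<Rightarrow> ('c, 'm, 's) program \<Rightarrow>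
     ('c, 'm, 's) action \<Rightarrow> 's \<Rightarrow> ('s \<times> ('c, 'm, 's) action) faulting" where
  "step f P (t, Exec c) \<sigma> =
    (case f t c \<sigma> of
       Fault \<Rightarrow> Fault
     | Outcomes A \<Rightarrow> Outcomes {(\<sigma>', (t, Exec c)) | \<sigma>'. \<sigma>' \<in> A})"
| "step f (Complete Cs L) (t, Call m a) \<sigma> = Outcomes {(\<sigma>, (t, Call m a))}"
| "step f (Complete Cs L) (t, Ret m a) \<sigma> = Outcomes {(\<sigma>, (t, Ret m a))}"
| "step f (SpecLib L \<Gamma>) (t, Call m a) \<sigma> =
    (case \<Gamma> m of
       None \<Rightarrow> Outcomes {(\<sigma>, (t, Call m a))}
     | Some (p, q) \<Rightarrow>
         Outcomes {(\<sigma>', (t, Call m (Some \<sigma>p))) | \<sigma>' \<sigma>p. \<sigma>p \<in> p t \<and> \<sigma> \<star> \<sigma>p = Some \<sigma>'})"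
| "step f (SpecLib L \<Gamma>) (t, Ret m a) \<sigma> =
    (case \<Gamma> m of
       None \<Rightarrow> Outcomes {(\<sigma>, (t, Ret m a))}
     | Some (p, q) \<Rightarrow>
         (case split_pred \<sigma> (q t) of
            None \<Rightarrow> Fault
          | Some (\<sigma>q, \<sigma>') \<Rightarrow> Outcomes {(\<sigma>', (t, Ret m (Some \<sigma>q)))}))"
| "step f (SpecClient \<Gamma> Cs) (t, Call m a) \<sigma> =
    (case \<Gamma> m of
       None \<Rightarrow> Outcomes {(\<sigma>, (t, Call m a))}
     | Some (p, q) \<Rightarrow>
         (case split_pred \<sigma> (p t) of
            None \<Rightarrow> Fault
          | Some (\<sigma>p, \<sigma>') \<Rightarrow> Outcomes {(\<sigma>', (t, Call m (Some \<sigma>p)))}))"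
| "step f (SpecClient \<Gamma> Cs) (t, Ret m a) \<sigma> =
    (case \<Gamma> m of
       None \<Rightarrow> Outcomes {(\<sigma>, (t, Ret m a))}
     | Some (p, q) \<Rightarrow>
         Outcomes {(\<sigma>', (t, Ret m (Some \<sigma>q))) | \<sigma>' \<sigma>q. \<sigma>q \<in> q t \<and> \<sigma> \<star> \<sigma>q = Some \<sigma>'})"

definition extend ::
    "('c, 's::separation_algebra) transformer \<Rightarrow> ('c, 'm, 's) program \<Rightarrow>
     ('s \<times> ('c, 'm, 's) trace) faulting \<Rightarrow> ('c, 'm, 's) action \<Rightarrow>
     ('s \<times> ('c, 'm, 's) trace) faulting" where
  "extend f P R \<phi> =
    (case R of
       Fault \<Rightarrow> Fault
     | Outcomes A \<Rightarrow>
         if \<exists>(\<sigma>', \<tau>')\<in>A. step f P \<phi> \<sigma>' = Fault then Fault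
         else Outcomes {(\<sigma>'', \<tau>' @ [\<phi>']) | \<sigma>'' \<tau>' \<phi>'.
                \<exists>\<sigma>' B. (\<sigma>', \<tau>') \<in> A \<and> step f P \<phi> \<sigma>' = Outcomes B \<and> (\<sigma>'', \<phi>') \<in> B})"

definition eval_trace ::
    "('c, 's::separation_algebra) transformer \<Rightarrow> ('c, 'm, 's) program \<Rightarrow> 's \<Rightarrow>
     ('c, 'm, 's) trace \<Rightarrow> ('s \<times> ('c, 'm, 's) trace) faulting" where
  "eval_trace f P \<sigma> \<tau> = foldl (extend f P) (Outcomes {(\<sigma>, [])}) \<tau>"

definition denot ::
    "('c, 's::separation_algebra) transformer \<Rightarrow> ('c, 'm, 's) program \<Rightarrow> 's \<Rightarrow>
     ('c, 'm, 's) trace faulting" where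
  "denot f P \<sigma> =
    (if \<exists>\<tau>\<in>traces P. eval_trace f P \<sigma> \<tau> = Fault then Fault
     else Outcomes {\<tau>'. \<exists>\<tau>\<in>traces P. \<exists>A \<sigma>'. eval_trace f P \<sigma> \<tau> = Outcomes A \<and> (\<sigma>', \<tau>') \<in> A})"

definition safe ::
    "('c, 's::separation_algebra) transformer \<Rightarrow> ('c, 'm, 's) program \<Rightarrow> 's set \<Rightarrow> bool" where
  "safe f P I \<longleftrightarrow> (\<forall>\<sigma>\<in>I. denot f P \<sigma> \<noteq> Fault)"

definition denot_from ::
    "('c, 's::separation_algebra) transformer \<Rightarrow> ('c, 'm, 's) program \<Rightarrow> 's set \<Rightarrow>
     ('s \<times> ('c, 'm, 's) trace) set" where
  "denot_from f P I = {(\<sigma>, \<tau>). \<sigma> \<in> I \<and> (\<exists>T. denot f P \<sigma> = Outcomes T \<and> \<tau> \<in> T)}"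

definition interf ::
    "('c, 's::separation_algebra) transformer \<Rightarrow> ('c, 'm) library \<Rightarrow> ('m, 's) spec \<Rightarrow> 's set \<Rightarrow>
     ('s set \<times> ('c, 'm, 's) trace) set" where
  "interf f L \<Gamma> I = {(\<delta> \<sigma>0, history \<tau>) | \<sigma>0 \<tau>. (\<sigma>0, \<tau>) \<in> denot_from f (SpecLib L \<Gamma>) I}"

definition linearized_by ::
    "('c, 's::separation_algebra) transformer \<Rightarrow> ('m, 's) spec \<Rightarrow>
     ('c, 'm) library \<Rightarrow> 's set \<Rightarrow> ('c, 'm) library \<Rightarrow> 's set \<Rightarrow> bool" where
  "linearized_by f \<Gamma> L1 I1 L2 I2 \<longleftrightarrow> interf_le (interf f L1 \<Gamma> I1) (interf f L2 \<Gamma> I2)"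

end

theory Submission
  imports Defs "HOL-Library.Multiset"
begin

text \<open>
  A run of the complete program with the first library splits into a client-local run and a
  library-local run with the same history \<open>H\<close>; strong locality excludes faults. Linearizability
  provides a run of the second library with a history \<open>H'\<close> above \<open>H\<close>. To merge the client run with it,
  follow the second library's run and let each return wait until the client run reaches it, and
  whenever the library reaches a call, first run the client up to and including that call. Returns
  met on the way are already waiting, because the order between a return and a later call in \<open>H\<close> is
  kept in \<open>H'\<close>; calls met on the way happen early. The global state is always the sum of the client
  state, the library state and the states transferred by the waiting returns and the early calls. All
  interface actions preserve this sum, and footprint preservation together with strong locality
  allows every command to run in the larger state, so no balancedness of intermediate histories has to
  be established: it suffices that the initial states are compatible.
\<close>

section \<open>Sums of states\<close>

text \<open>The conclusion fixes the client projection exactly, interface actions included, so the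
  client run cannot be rearranged to have the history \<open>H'\<close>. The merged trace therefore
  keeps the client run unchanged, its own history being \<open>H\<close>, and takes only the library
  commands and their order from the second library. In it a call stands no later, and a return no
  earlier, than the point at which the second library's run processes it, so every method body still
  runs inside its call and each thread performs the actions of the second library's run in the same
  order. Membership in the trace set of a parallel program constrains only the thread projections,
  so per-thread agreement is all that has to be maintained. In each thread at most one interface
  action is out of step. After an early call the client thread can only return, which has to wait
  for the library; after a delayed return the library thread can only call, and that call is placed
  by the client after the return.\<close>

lemma sep_assocD:
  fixes x y z u w :: "'s::separation_algebra"
  assumes "x \<star> y = Some u" "u \<star> z = Some w"
  shows "\<exists>v. y \<star> z = Some v \<and> x \<star> v = Some w"
  using sep_assoc[of x y z] assms by (cases "y \<star> z") auto

lemma sep_unit_right: "x \<star> sep_unit = Some (x :: 's::separation_algebra)"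
  by (metis sep_commute sep_unit)

lemma fp_eq_defined:
  assumes "\<delta> x = \<delta> y"
  shows "x \<star> z \<noteq> None \<longleftrightarrow> y \<star> z \<noteq> None"
proof -
  have "x \<in> fp_of (\<star>) x" by (simp add: fp_of_def)
  then have "x \<in> fp_of (\<star>) y" using assms by (simp add: fp_def)
  then show ?thesis by (simp add: fp_of_def)
qed

text \<open>The comparison of initial footprints enters the proof only in this form: whatever is
  compatible with the larger footprint is compatible with the smaller one. With representatives
  \<open>a \<star> c = b\<close>, a partner of \<open>b\<close> is a partner of \<open>a\<close> by
  reassociation, and equal footprints have the same partners.\<close>

lemma fp_le_defined:
  assumes "\<delta> x \<preceq> \<delta> y" "y \<star> z \<noteq> None"
  shows "x \<star> z \<noteq> None"
proof -
  obtain a b c where abc: "\<delta> x = \<delta> a" "\<delta> y = \<delta> b" "a \<star> c = Some b"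
    using assms(1) by (auto simp: fp_le_def fp_sub_def split: if_splits)
  obtain u where "b \<star> z = Some u"
    using assms(2) fp_eq_defined[OF abc(2)] by auto
  then obtain v where "c \<star> z = Some v" "a \<star> v = Some u"
    using sep_assocD[OF abc(3)] by blast
  moreover have "c \<star> a = Some b"
    using abc(3) by (simp add: sep_commute)
  ultimately have "a \<star> z \<noteq> None"
    using sep_assocD[OF \<open>c \<star> a = Some b\<close> \<open>b \<star> z = Some u\<close>] by blast
  then show ?thesis using fp_eq_defined[OF abc(1)] by auto
qed

text \<open>A sum over a multiset, because waiting returns and early calls are consumed in an order
  unrelated to the one in which they arose. Being partial, it is folded through
  \<open>Option.bind\<close>: one undefined partial sum makes the whole undefined.\<close>

definition msum :: "'s::separation_algebra multiset \<Rightarrow> 's option" where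
  "msum M = fold_mset (\<lambda>x r. Option.bind r ((\<star>) x)) (Some sep_unit) M"

lemma bind_sep_left_commute:
  fixes x y :: "'s::separation_algebra"
  shows "Option.bind (y \<star> r) ((\<star>) x) = Option.bind (x \<star> r) ((\<star>) y)"
  using sep_assoc[of x y r] sep_assoc[of y x r] sep_commute[of x y] by simp

lemma msum_empty: "msum {#} = Some sep_unit"
  by (simp add: msum_def)

lemma msum_add: "msum (add_mset x M) = Option.bind (msum M) ((\<star>) x)"
proof -
  interpret comp_fun_commute "\<lambda>(x::'a) r. Option.bind r ((\<star>) x)"
  proof
    fix x y :: 'a
    show "(\<lambda>r. Option.bind r ((\<star>) y)) \<circ> (\<lambda>r. Option.bind r ((\<star>) x)) =
        (\<lambda>r. Option.bind r ((\<star>) x)) \<circ> (\<lambda>r. Option.bind r ((\<star>) y))" (is "?l = ?r")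
    proof
      fix r show "?l r = ?r r"
        by (cases r) (simp_all add: bind_sep_left_commute[of x])
    qed
  qed
  show ?thesis by (simp add: msum_def)
qed

lemma msum_pair: "msum {#x, y#} = x \<star> y"
  by (simp add: msum_add msum_empty sep_unit_right)

text \<open>Reassociation inside a sum. Every interface action is such a regrouping: it detaches a
  transferred state from one component or merges it into the other, and the global state does not
  change.\<close>

lemma msum_split:
  assumes "x \<star> y = Some z"
  shows "msum (add_mset x (add_mset y M)) = msum (add_mset z M)"
  using sep_assoc[of x y] assms by (cases "msum M") (auto simp: msum_add)

section \<open>Projections of traces\<close>

lemma act_kind_simps [simp]:
  "is_exec (t, Exec c)" "\<not> is_exec (t, Call m a)" "\<not> is_exec (t, Ret m a)"
  "\<not> is_call (t, Exec c)" "is_call (t, Call m a)" "\<not> is_call (t, Ret m a)"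
  "\<not> is_ret (t, Exec c)" "\<not> is_ret (t, Call m a)" "is_ret (t, Ret m a)"
  by (auto simp: is_exec_def is_call_def is_ret_def)

lemma action_cases [case_names Exec Call Ret]:
  obtains t c where "\<phi> = (t, Exec c)"
  | t m a where "\<phi> = (t, Call m a)"
  | t m a where "\<phi> = (t, Ret m a)"
  by (metis act.exhaust surj_pair)

lemma not_is_exec: "\<not> is_exec \<phi> \<longleftrightarrow> is_call \<phi> \<or> is_ret \<phi>"
  by (cases \<phi> rule: action_cases) auto

lemma is_call_not_is_ret: "is_call \<phi> \<Longrightarrow> \<not> is_ret \<phi>"
  by (cases \<phi> rule: action_cases) auto

abbreviation thread_proj :: "tid \<Rightarrow> ('c, 'm, 's) trace \<Rightarrow> ('c, 'm, 's) trace" where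
  "thread_proj t \<tau> \<equiv> filter (\<lambda>\<phi>. fst \<phi> = t) \<tau>"

definition thread_history :: "tid \<Rightarrow> ('c, 'm, 's) trace \<Rightarrow> ('c, 'm, 's) trace" where
  "thread_history t \<tau> = filter (\<lambda>\<phi>. fst \<phi> = t \<and> \<not> is_exec \<phi>) \<tau>"

text \<open>The position-based notion of an open call, recast so that appending one action is easy
  to handle: only the last interface action of the thread matters.\<close>

definition in_call :: "tid \<Rightarrow> ('c, 'm, 's) trace \<Rightarrow> bool" where
  "in_call t \<tau> \<longleftrightarrow> thread_history t \<tau> \<noteq> [] \<and> is_call (last (thread_history t \<tau>))"

definition lib :: "('c, 'm, 's) trace \<Rightarrow> ('c, 'm, 's) trace" where
  "lib \<tau> = nths \<tau> {i. library_action \<tau> i \<or> is_call (\<tau> ! i) \<or> is_ret (\<tau> ! i)}"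

lemma thread_history_append [simp]:
  "thread_history t (\<tau> @ \<tau>') = thread_history t \<tau> @ thread_history t \<tau>'"
  by (simp add: thread_history_def)

lemma thread_history_Nil [simp]: "thread_history t [] = []"
  by (simp add: thread_history_def)

lemma thread_history_Cons:
  "thread_history t (\<phi> # \<tau>) = (if fst \<phi> = t \<and> \<not> is_exec \<phi> then [\<phi>] else []) @ thread_history t \<tau>"
  by (simp add: thread_history_def)

lemma thread_history_thread_proj [simp]: "thread_history t (thread_proj t \<tau>) = thread_history t \<tau>"
  by (auto simp: thread_history_def intro: filter_cong)

lemma thread_proj_history: "thread_proj t (history \<tau>) = thread_history t \<tau>"
  by (auto simp: thread_history_def history_def not_is_exec intro: filter_cong)

lemma in_call_Nil [simp]: "\<not> in_call t []"
  by (simp add: in_call_def)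

lemma in_call_snoc:
  "in_call t (\<tau> @ [\<phi>]) \<longleftrightarrow> (if fst \<phi> = t \<and> \<not> is_exec \<phi> then is_call \<phi> else in_call t \<tau>)"
  by (auto simp: in_call_def thread_history_Cons)

lemma in_call_append_not:
  "\<not> in_call t \<tau> \<Longrightarrow> in_call t (\<tau> @ \<tau>') \<longleftrightarrow> in_call t \<tau>'"
  by (auto simp: in_call_def last_append)

text \<open>Alternation of calls and returns need not be assumed. If no return follows some call of
  the thread, its later interface actions are all calls, so the last one is a call.\<close>

lemma in_call_iff_pending:
  "in_call t \<tau> \<longleftrightarrow> (\<exists>j<length \<tau>. fst (\<tau> ! j) = t \<and> is_call (\<tau> ! j) \<and>
     (\<forall>k. j < k \<and> k < length \<tau> \<longrightarrow> \<not> (fst (\<tau> ! k) = t \<and> is_ret (\<tau> ! k))))"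
    (is "_ \<longleftrightarrow> ?P \<tau>")
proof (induction \<tau> rule: rev_induct)
  case (snoc \<phi> \<tau>)
  have "?P (\<tau> @ [\<phi>]) \<longleftrightarrow> fst \<phi> = t \<and> is_call \<phi> \<or> ?P \<tau> \<and> \<not> (fst \<phi> = t \<and> is_ret \<phi>)" (is "?l \<longleftrightarrow> ?r")
  proof
    assume ?l
    then obtain j where j: "j < Suc (length \<tau>)" "fst ((\<tau> @ [\<phi>]) ! j) = t" "is_call ((\<tau> @ [\<phi>]) ! j)"
      and nr: "\<And>k. j < k \<Longrightarrow> k < Suc (length \<tau>) \<Longrightarrow>
        \<not> (fst ((\<tau> @ [\<phi>]) ! k) = t \<and> is_ret ((\<tau> @ [\<phi>]) ! k))"
      by auto
    show ?r
    proof (cases "j = length \<tau>")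
      case False
      then have "j < length \<tau>" using j by simp
      moreover have "\<not> (fst (\<tau> ! k) = t \<and> is_ret (\<tau> ! k))" if "j < k" "k < length \<tau>" for k
        using nr[of k] that by (simp add: nth_append)
      ultimately show ?thesis
        using j nr[of "length \<tau>"] by (auto simp: nth_append)
    qed (use j in auto)
  next
    assume ?r
    then show ?l
    proof
      assume "fst \<phi> = t \<and> is_call \<phi>"
      then show ?l by (intro exI[of _ "length \<tau>"]) auto
    next
      assume A: "?P \<tau> \<and> \<not> (fst \<phi> = t \<and> is_ret \<phi>)"
      then obtain j where "j < length \<tau>" "fst (\<tau> ! j) = t" "is_call (\<tau> ! j)"
        "\<And>k. j < k \<Longrightarrow> k < length \<tau> \<Longrightarrow> \<not> (fst (\<tau> ! k) = t \<and> is_ret (\<tau> ! k))" by blast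
      then show ?l using A
        by (intro exI[of _ j]) (auto simp: nth_append less_Suc_eq)
    qed
  qed
  then show ?case
    using snoc by (auto simp: in_call_snoc not_is_exec dest: is_call_not_is_ret)
qed simp

lemma library_action_snoc:
  "i < length \<tau> \<Longrightarrow> library_action (\<tau> @ [\<phi>]) i \<longleftrightarrow> library_action \<tau> i"
  by (auto simp: library_action_def nth_append)

lemma library_action_last:
  "library_action (\<tau> @ [\<phi>]) (length \<tau>) \<longleftrightarrow> is_exec \<phi> \<and> in_call (fst \<phi>) \<tau>"
  by (auto simp: library_action_def in_call_iff_pending nth_append)

lemma nths_eqI:
  assumes "\<And>i. i < length xs \<Longrightarrow> i \<in> A \<longleftrightarrow> i \<in> B"
  shows "nths xs A = nths xs B"
proof -
  have "filter (\<lambda>p. snd p \<in> A) (zip xs [0..<length xs]) = filter (\<lambda>p. snd p \<in> B) (zip xs [0..<length xs])"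
    using assms by (intro filter_cong) (auto simp: in_set_zip)
  then show ?thesis by (simp add: nths_def)
qed

text \<open>Whether an action is kept depends only on the actions before it, so the index-based
  projection satisfies a recursion at the end of the trace. Further facts about
  \<open>client\<close> are derived from this equation by reverse induction.\<close>

lemma client_snoc:
  "client (\<tau> @ [\<phi>]) = client \<tau> @ (if is_exec \<phi> \<and> in_call (fst \<phi>) \<tau> then [] else [\<phi>])"
proof -
  have "nths \<tau> {i. client_action (\<tau> @ [\<phi>]) i \<or> is_call ((\<tau> @ [\<phi>]) ! i) \<or> is_ret ((\<tau> @ [\<phi>]) ! i)} =
      client \<tau>"
    unfolding client_def
    by (rule nths_eqI) (auto simp: client_action_def library_action_snoc nth_append)
  then show ?thesis
    unfolding client_def[of "\<tau> @ [\<phi>]"]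
    by (simp add: nths_append nths_singleton client_action_def library_action_last
        not_is_exec[symmetric])
qed

lemma lib_snoc:
  "lib (\<tau> @ [\<phi>]) = lib \<tau> @ (if is_exec \<phi> \<and> \<not> in_call (fst \<phi>) \<tau> then [] else [\<phi>])"
proof -
  have "nths \<tau> {i. library_action (\<tau> @ [\<phi>]) i \<or> is_call ((\<tau> @ [\<phi>]) ! i) \<or> is_ret ((\<tau> @ [\<phi>]) ! i)} =
      lib \<tau>"
    unfolding lib_def
    by (rule nths_eqI) (auto simp: library_action_snoc nth_append)
  then show ?thesis
    unfolding lib_def[of "\<tau> @ [\<phi>]"]
    by (auto simp add: nths_append nths_singleton library_action_last
        not_is_exec[symmetric])
qed

lemma client_Nil [simp]: "client [] = []" by (simp add: client_def)
lemma lib_Nil [simp]: "lib [] = []" by (simp add: lib_def)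

lemma set_client_subset: "set (client \<tau>) \<subseteq> set \<tau>"
  by (simp add: client_def set_nths_subset)

lemma set_lib_subset: "set (lib \<tau>) \<subseteq> set \<tau>"
  by (simp add: lib_def set_nths_subset)

lemma thread_history_client [simp]: "thread_history t (client \<tau>) = thread_history t \<tau>"
  by (induction \<tau> rule: rev_induct) (auto simp: client_snoc thread_history_Cons)

lemma thread_history_lib [simp]: "thread_history t (lib \<tau>) = thread_history t \<tau>"
  by (induction \<tau> rule: rev_induct) (auto simp: lib_snoc thread_history_Cons)

text \<open>A dropped command has an earlier call by the same thread, and calls are kept. Hence a
  bound on the threads of the client projection bounds the threads of the whole trace.\<close>

lemma fst_client: "fst ` set (client \<tau>) = fst ` set \<tau>"
proof (induction \<tau> rule: rev_induct)
  case (snoc \<phi> \<tau>)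
  have "fst \<phi> \<in> fst ` set \<tau>" if "in_call (fst \<phi>) \<tau>"
    using that by (auto simp: in_call_def thread_history_def filter_empty_conv intro: rev_image_eqI)
  then show ?case using snoc by (auto simp: client_snoc)
qed simp

lemma in_call_cong: "thread_history t \<tau> = thread_history t \<tau>' \<Longrightarrow> in_call t \<tau> \<longleftrightarrow> in_call t \<tau>'"
  by (simp add: in_call_def)

lemma thread_proj_client: "thread_proj t (client \<tau>) = client (thread_proj t \<tau>)"
proof (induction \<tau> rule: rev_induct)
  case (snoc \<phi> \<tau>)
  have "in_call t (thread_proj t \<tau>) = in_call t \<tau>" by (rule in_call_cong) simp
  with snoc show ?case by (auto simp: client_snoc)
qed simp

lemma thread_proj_lib: "thread_proj t (lib \<tau>) = lib (thread_proj t \<tau>)"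
proof (induction \<tau> rule: rev_induct)
  case (snoc \<phi> \<tau>)
  have "in_call t (thread_proj t \<tau>) = in_call t \<tau>" by (rule in_call_cong) simp
  with snoc show ?case by (auto simp: lib_snoc)
qed simp

lemma client_append_prefix: "\<exists>\<rho>. client (\<tau> @ \<tau>') = client \<tau> @ \<rho>"
proof (induction \<tau>' rule: rev_induct)
  case (snoc \<phi> \<tau>')
  then show ?case using client_snoc[of "\<tau> @ \<tau>'" \<phi>] by auto
qed simp

lemma lib_append_prefix: "\<exists>\<rho>. lib (\<tau> @ \<tau>') = lib \<tau> @ \<rho>"
proof (induction \<tau>' rule: rev_induct)
  case (snoc \<phi> \<tau>')
  then show ?case using lib_snoc[of "\<tau> @ \<tau>'" \<phi>] by auto
qed simp

lemma client_append:
  assumes "\<And>t. \<not> in_call t \<tau>"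
  shows "client (\<tau> @ \<tau>') = client \<tau> @ client \<tau>'"
proof (induction \<tau>' rule: rev_induct)
  case (snoc \<phi> \<tau>')
  then show ?case using client_snoc[of "\<tau> @ \<tau>'" \<phi>] client_snoc[of \<tau>' \<phi>] assms
    by (simp add: in_call_append_not)
qed simp

lemma lib_append:
  assumes "\<And>t. \<not> in_call t \<tau>"
  shows "lib (\<tau> @ \<tau>') = lib \<tau> @ lib \<tau>'"
proof (induction \<tau>' rule: rev_induct)
  case (snoc \<phi> \<tau>')
  then show ?case using lib_snoc[of "\<tau> @ \<tau>'" \<phi>] lib_snoc[of \<tau>' \<phi>] assms
    by (simp add: in_call_append_not)
qed simp

lemma client_Exec_Cons: "client ((t, Exec c) # \<tau>) = (t, Exec c) # client \<tau>"
proof -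
  have "\<not> in_call t' [(t, Exec c)]" for t'
    using in_call_snoc[of t' "[]" "(t, Exec c)"] by simp
  from client_append[of "[(t, Exec c)]" \<tau>, OF this] show ?thesis
    using client_snoc[of "[]" "(t, Exec c)"] by simp
qed

lemma lib_Exec_Cons: "lib ((t, Exec c) # \<tau>) = lib \<tau>"
proof -
  have "\<not> in_call t' [(t, Exec c)]" for t'
    using in_call_snoc[of t' "[]" "(t, Exec c)"] by simp
  from lib_append[of "[(t, Exec c)]" \<tau>, OF this] show ?thesis
    using lib_snoc[of "[]" "(t, Exec c)"] by simp
qed

section \<open>Blocks formed by a single method call\<close>

definition execs_of :: "tid \<Rightarrow> ('c, 'm, 's) trace \<Rightarrow> bool" where
  "execs_of t \<tau> \<longleftrightarrow> (\<forall>\<phi>\<in>set \<tau>. fst \<phi> = t \<and> is_exec \<phi>)"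

text \<open>The shape of a block cut off before its return, as it occurs at the end of a prefix; the
  client sees the call only, the library everything.\<close>

lemma open_call_projections:
  assumes "execs_of t b"
  shows "client ((t, Call m a) # b) = [(t, Call m a)]"
    and "lib ((t, Call m a) # b) = (t, Call m a) # b"
    and "in_call t' ((t, Call m a) # b) \<longleftrightarrow> t' = t"
proof -
  have "client ((t, Call m a) # b) = [(t, Call m a)] \<and> lib ((t, Call m a) # b) = (t, Call m a) # b \<and>
    (\<forall>t'. in_call t' ((t, Call m a) # b) \<longleftrightarrow> t' = t)"
    using assms
  proof (induction b rule: rev_induct)
    case Nil
    show ?case
      using client_snoc[of "[]" "(t, Call m a)"] lib_snoc[of "[]" "(t, Call m a)"]
      by (auto simp: in_call_def thread_history_def)
  next
    case (snoc \<phi> b)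
    then have "execs_of t b" "fst \<phi> = t" "is_exec \<phi>" by (auto simp: execs_of_def)
    with snoc.IH show ?case
      using client_snoc[of "(t, Call m a) # b" \<phi>] lib_snoc[of "(t, Call m a) # b" \<phi>]
        in_call_snoc[of _ "(t, Call m a) # b" \<phi>] by simp
  qed
  then show "client ((t, Call m a) # b) = [(t, Call m a)]"
    and "lib ((t, Call m a) # b) = (t, Call m a) # b"
    and "in_call t' ((t, Call m a) # b) \<longleftrightarrow> t' = t" by simp_all
qed

lemma closed_call_projections:
  assumes "execs_of t b"
  shows "client ((t, Call m a) # b @ [(t, Ret m' a')]) = [(t, Call m a), (t, Ret m' a')]"
    and "lib ((t, Call m a) # b @ [(t, Ret m' a')]) = (t, Call m a) # b @ [(t, Ret m' a')]"
    and "\<not> in_call t' ((t, Call m a) # b @ [(t, Ret m' a')])"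
  using open_call_projections[OF assms]
    client_snoc[of "(t, Call m a) # b" "(t, Ret m' a')"]
    lib_snoc[of "(t, Call m a) # b" "(t, Ret m' a')"]
    in_call_snoc[of t' "(t, Call m a) # b" "(t, Ret m' a')"]
  by auto

section \<open>Trace sets\<close>

abbreviation skip_env :: "('c, 'm, 's) method_env" where
  "skip_env \<equiv> \<lambda>_ _. {[]}"

lemma iter_traces_Nil: "[] \<in> iter_traces A"
  unfolding iter_traces_def by (rule CollectI, rule exI[of _ "[]"]) simp

lemma iter_traces_append: "\<tau> \<in> iter_traces A \<Longrightarrow> \<tau>' \<in> iter_traces A \<Longrightarrow> \<tau> @ \<tau>' \<in> iter_traces A"
  unfolding iter_traces_def
proof (elim CollectE exE conjE)
  fix ts ts' assume "\<tau> = concat ts" "set ts \<subseteq> A" "\<tau>' = concat ts'" "set ts' \<subseteq> A"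
  then show "\<tau> @ \<tau>' \<in> {concat ts |ts. set ts \<subseteq> A}"
    by (intro CollectI exI[of _ "ts @ ts'"]) simp
qed

lemma iter_traces_base: "\<tau> \<in> A \<Longrightarrow> \<tau> \<in> iter_traces A"
  unfolding iter_traces_def by (rule CollectI, rule exI[of _ "[\<tau>]"]) simp

lemma iter_traces_induct [consumes 1, case_names Nil append]:
  assumes "\<tau> \<in> iter_traces A"
    and "P []"
    and "\<And>\<rho> \<rho>'. \<rho> \<in> A \<Longrightarrow> \<rho>' \<in> iter_traces A \<Longrightarrow> P \<rho>' \<Longrightarrow> P (\<rho> @ \<rho>')"
  shows "P \<tau>"
proof -
  obtain ts where "\<tau> = concat ts" "set ts \<subseteq> A" using assms(1) by (auto simp: iter_traces_def)
  moreover have "concat ts \<in> iter_traces A \<and> P (concat ts)" if "set ts \<subseteq> A" for ts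
    using that
  proof (induction ts)
    case Nil
    then show ?case using assms(2) iter_traces_Nil by simp
  next
    case (Cons \<rho> ts)
    then show ?case using assms(3)[of \<rho> "concat ts"] iter_traces_append[OF iter_traces_base[of \<rho> A]]
      by simp
  qed
  ultimately show ?thesis by blast
qed

text \<open>Under an environment without bodies a method call has no trace at all, so a trace that
  exists is built from primitive commands of the thread.\<close>

lemma cmd_traces_no_methods: "\<tau> \<in> cmd_traces (\<lambda>_ _. {}) t C \<Longrightarrow> execs_of t \<tau>"
proof (induction C arbitrary: \<tau>)
  case (Iter C)
  have "\<tau> \<in> iter_traces (cmd_traces (\<lambda>_ _. {}) t C)" using Iter.prems by simp
  then show ?case
    using Iter.IH by (induction rule: iter_traces_induct) (auto simp: execs_of_def)
qed (fastforce simp: execs_of_def)+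

lemma lib_env_execs: "b \<in> lib_env L m t \<Longrightarrow> execs_of t b"
  by (auto simp: lib_env_def cmd_traces_no_methods split: option.splits)

text \<open>Program traces are prefixes of completed runs. To complete a prefix, every method that
  the client may still call needs at least one full body; that such a body exists is the purpose of
  this lemma.\<close>

lemma cmd_traces_nonempty:
  "(\<And>m. m \<in> methods_of C \<Longrightarrow> \<eta> m t \<noteq> {}) \<Longrightarrow> cmd_traces \<eta> t C \<noteq> {}"
  using iter_traces_Nil by (induction C) fastforce+

lemma lib_env_nonempty:
  assumes "wf_library L" "m \<in> dom L"
  shows "lib_env L m t \<noteq> {}"
proof -
  obtain C where C: "L m = Some C" using assms(2) by auto
  then have "methods_of C = {}" using assms(1) by (auto simp: wf_library_def ran_def)
  then show ?thesis
    using cmd_traces_nonempty[of C "\<lambda>_ _. {}" t] C by (simp add: lib_env_def)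
qed

text \<open>The third conjunct carries the induction: both projections distribute over a
  concatenation when no call is open at the cut.\<close>

lemma cmd_traces_decomposition:
  assumes "\<tau> \<in> cmd_traces (lib_env L) t C"
  shows "client \<tau> \<in> cmd_traces skip_env t C \<and> lib \<tau> \<in> mgc_traces L t \<and> (\<forall>t'. \<not> in_call t' \<tau>)"
  using assms
proof (induction C arbitrary: \<tau>)
  case (Prim c)
  then have "\<tau> = [(t, Exec c)]" by simp
  then show ?case
    by (simp add: client_Exec_Cons lib_Exec_Cons in_call_def thread_history_def
        mgc_traces_def iter_traces_Nil)
next
  case (Meth m)
  then obtain b where \<tau>: "\<tau> = (t, Call m None) # b @ [(t, Ret m None)]" and b: "b \<in> lib_env L m t"
    by auto
  have "m \<in> dom L" using b by (auto simp: lib_env_def split: option.splits)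
  then have "\<tau> \<in> mgc_traces L t"
    unfolding mgc_traces_def using \<tau> b by (intro iter_traces_base) auto
  then show ?case
    using closed_call_projections[OF lib_env_execs[OF b]] \<tau> by simp
next
  case (Seq C1 C2)
  then obtain \<tau>1 \<tau>2 where \<tau>: "\<tau> = \<tau>1 @ \<tau>2" "\<tau>1 \<in> cmd_traces (lib_env L) t C1"
    "\<tau>2 \<in> cmd_traces (lib_env L) t C2" by auto
  note IH = Seq.IH(1)[OF \<tau>(2)] Seq.IH(2)[OF \<tau>(3)]
  have "\<not> in_call t' \<tau>" for t' using IH \<tau>(1) by (simp add: in_call_append_not)
  then show ?case
    using IH \<tau>(1) by (auto simp: client_append lib_append mgc_traces_def iter_traces_append)
next
  case (Choice C1 C2)
  then show ?case by auto
next
  case (Iter C)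
  have "\<tau> \<in> iter_traces (cmd_traces (lib_env L) t C)" using Iter.prems by simp
  then show ?case
  proof (induction rule: iter_traces_induct)
    case Nil
    then show ?case by (simp add: iter_traces_Nil mgc_traces_def)
  next
    case (append \<rho> \<rho>')
    note IH = Iter.IH[OF append(1)] append(3)
    have "\<not> in_call t' (\<rho> @ \<rho>')" for t' using IH by (simp add: in_call_append_not)
    then show ?case
      using IH by (auto simp: client_append lib_append mgc_traces_def iter_traces_append iter_traces_base)
  qed
qed

lemma client_traces_decomposition:
  assumes "\<tau> \<in> traces (Complete Cs L)"
  shows "client \<tau> \<in> traces (SpecClient \<Gamma> Cs)" and "lib \<tau> \<in> traces (SpecLib L \<Gamma>)"
proof -
  let ?n = "length Cs"
  obtain \<tau>' where full: "\<tau> @ \<tau>' \<in> client_traces (lib_env L) Cs"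
    using assms by (auto simp: prefix_closure_def)
  have thr: "\<forall>\<phi>\<in>set (\<tau> @ \<tau>'). fst \<phi> \<in> {1..?n}"
    and loc: "\<And>t. t \<in> {1..?n} \<Longrightarrow>
      thread_proj t (\<tau> @ \<tau>') \<in> cmd_traces (lib_env L) t (Cs ! (t - 1))"
    using full by (auto simp: client_traces_def par_traces_def)
  have "client (\<tau> @ \<tau>') \<in> client_traces skip_env Cs"
    unfolding client_traces_def par_traces_def
  proof (intro CollectI conjI ballI)
    show "fst \<phi> \<in> {1..?n}" if "\<phi> \<in> set (client (\<tau> @ \<tau>'))" for \<phi>
      using that thr set_client_subset by blast
    show "thread_proj t (client (\<tau> @ \<tau>')) \<in> cmd_traces skip_env t (Cs ! (t - 1))"
      if "t \<in> {1..?n}" for t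
      using cmd_traces_decomposition[OF loc[OF that]] by (simp only: thread_proj_client)
  qed
  then show "client \<tau> \<in> traces (SpecClient \<Gamma> Cs)"
    using client_append_prefix[of \<tau> \<tau>'] by (auto simp: prefix_closure_def)
  have mgc: "thread_proj t (lib (\<tau> @ \<tau>')) \<in> mgc_traces L t" for t
  proof (cases "t \<in> {1..?n}")
    case True
    then show ?thesis using cmd_traces_decomposition[OF loc] by (simp add: thread_proj_lib)
  next
    case False
    then have "thread_proj t (\<tau> @ \<tau>') = []" using thr by (auto simp: filter_empty_conv)
    then show ?thesis using thread_proj_lib[of t "\<tau> @ \<tau>'"]
      by (simp add: iter_traces_Nil mgc_traces_def)
  qed
  \<comment> \<open>The trace set of a library takes at least one copy of the most general client,
    whereas the list of client threads may be empty. The successor covers this case, and the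
    additional thread contributes the empty trace.\<close>
  have "lib (\<tau> @ \<tau>') \<in> par_traces (Suc ?n) (mgc_traces L)"
    unfolding par_traces_def
    using thr set_lib_subset[of "\<tau> @ \<tau>'"] mgc by fastforce
  then have "lib (\<tau> @ \<tau>') \<in> (\<Union>k\<in>{1..}. par_traces k (mgc_traces L))"
    by (rule UN_I[rotated]) simp
  moreover obtain \<rho> where "lib (\<tau> @ \<tau>') = lib \<tau> @ \<rho>"
    using lib_append_prefix by blast
  ultimately show "lib \<tau> \<in> traces (SpecLib L \<Gamma>)"
    unfolding traces.simps prefix_closure_def by (intro CollectI exI[of _ \<rho>]) simp
qed

section \<open>Filling method bodies into the trace of one thread\<close>

text \<open>Fills a body from \<open>\<eta>\<close> into each call block of a client-local trace of
  thread \<open>t\<close>. The command is not mentioned, so bodies can be exchanged block by block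
  without going through the structure of the command again.\<close>

inductive expands :: "('c, 'm, 's) method_env \<Rightarrow> tid \<Rightarrow> ('c, 'm, 's) trace \<Rightarrow> ('c, 'm, 's) trace \<Rightarrow> bool"
  for \<eta> t where
  expands_Nil: "expands \<eta> t [] []"
| expands_Exec: "expands \<eta> t \<rho> \<tau> \<Longrightarrow> expands \<eta> t ((t, Exec c) # \<rho>) ((t, Exec c) # \<tau>)"
| expands_Call: "b \<in> \<eta> m t \<Longrightarrow> expands \<eta> t \<rho> \<tau> \<Longrightarrow>
    expands \<eta> t ((t, Call m None) # (t, Ret m None) # \<rho>) ((t, Call m None) # b @ (t, Ret m None) # \<tau>)"

inductive_cases expands_ExecE: "expands \<eta> t ((t, Exec c) # \<rho>) \<tau>"
inductive_cases expands_CallE: "expands \<eta> t ((t, Call m None) # (t, Ret m None) # \<rho>) \<tau>"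

lemma expands_append:
  "expands \<eta> t \<rho> \<tau> \<Longrightarrow> expands \<eta> t \<rho>' \<tau>' \<Longrightarrow> expands \<eta> t (\<rho> @ \<rho>') (\<tau> @ \<tau>')"
  by (induction rule: expands.induct) (auto intro: expands.intros)

text \<open>The remainder \<open>\<rho>'\<close> is carried along so that sequencing and iteration
  can cut the expansion exactly where the trace of the first command ends; the intended case is the
  empty remainder.\<close>

lemma cmd_traces_expands_append:
  assumes "\<rho> \<in> cmd_traces skip_env t C" "expands \<eta> t (\<rho> @ \<rho>') \<tau>"
  shows "\<exists>\<tau>1 \<tau>2. \<tau> = \<tau>1 @ \<tau>2 \<and> \<tau>1 \<in> cmd_traces \<eta> t C \<and> expands \<eta> t \<rho>' \<tau>2"
  using assms
proof (induction C arbitrary: \<rho> \<rho>' \<tau>)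
  case (Prim c)
  then show ?case by (auto elim!: expands_ExecE)
next
  case (Meth m)
  then have "expands \<eta> t ((t, Call m None) # (t, Ret m None) # \<rho>') \<tau>" by auto
  then obtain b \<tau>' where "\<tau> = (t, Call m None) # b @ (t, Ret m None) # \<tau>'" "b \<in> \<eta> m t"
    "expands \<eta> t \<rho>' \<tau>'" by (elim expands_CallE) auto
  then show ?case
    by (intro exI[of _ "(t, Call m None) # b @ [(t, Ret m None)]"] exI[of _ \<tau>']) auto
next
  case (Seq C1 C2)
  then obtain \<rho>1 \<rho>2 where \<rho>: "\<rho> = \<rho>1 @ \<rho>2" "\<rho>1 \<in> cmd_traces skip_env t C1"
    "\<rho>2 \<in> cmd_traces skip_env t C2" by auto
  have "expands \<eta> t (\<rho>1 @ (\<rho>2 @ \<rho>')) \<tau>" using Seq.prems(2) \<rho>(1) by simp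
  from Seq.IH(1)[OF \<rho>(2) this] obtain \<tau>1 \<tau>' where
    1: "\<tau> = \<tau>1 @ \<tau>'" "\<tau>1 \<in> cmd_traces \<eta> t C1" "expands \<eta> t (\<rho>2 @ \<rho>') \<tau>'" by blast
  from Seq.IH(2)[OF \<rho>(3) 1(3)] obtain \<tau>2 \<tau>'' where
    "\<tau>' = \<tau>2 @ \<tau>''" "\<tau>2 \<in> cmd_traces \<eta> t C2" "expands \<eta> t \<rho>' \<tau>''" by blast
  with 1 show ?case by (intro exI[of _ "\<tau>1 @ \<tau>2"] exI[of _ \<tau>'']) auto
next
  case (Choice C1 C2)
  then show ?case by fastforce
next
  case (Iter C)
  have "\<rho> \<in> iter_traces (cmd_traces skip_env t C)" using Iter.prems by simp
  then show ?case using Iter.prems(2)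
  proof (induction arbitrary: \<rho>' \<tau> rule: iter_traces_induct)
    case Nil
    then show ?case by (intro exI[of _ "[]"] exI[of _ \<tau>]) (simp add: iter_traces_Nil)
  next
    case (append \<rho>1 \<rho>2)
    have "expands \<eta> t (\<rho>1 @ (\<rho>2 @ \<rho>')) \<tau>" using append.prems by simp
    from Iter.IH[OF append.hyps(1) this] obtain \<tau>1 \<tau>' where
      1: "\<tau> = \<tau>1 @ \<tau>'" "\<tau>1 \<in> cmd_traces \<eta> t C" "expands \<eta> t (\<rho>2 @ \<rho>') \<tau>'" by blast
    from append.IH[OF 1(3)] obtain \<tau>2 \<tau>'' where
      "\<tau>' = \<tau>2 @ \<tau>''" "\<tau>2 \<in> cmd_traces \<eta> t (Iter C)" "expands \<eta> t \<rho>' \<tau>''" by blast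
    with 1 show ?case
      by (intro exI[of _ "\<tau>1 @ \<tau>2"] exI[of _ \<tau>''])
        (auto simp: iter_traces_append iter_traces_base)
  qed
qed

lemma expands_cmd_traces:
  assumes "\<rho> \<in> cmd_traces skip_env t C" "expands \<eta> t \<rho> \<tau>"
  shows "\<tau> \<in> cmd_traces \<eta> t C"
  using cmd_traces_expands_append[of \<rho> t C \<eta> "[]" \<tau>] assms by (auto elim: expands.cases)

lemma expands_exists:
  assumes "\<rho> \<in> cmd_traces skip_env t C" "\<And>m. m \<in> methods_of C \<Longrightarrow> \<eta> m t \<noteq> {}"
  shows "\<exists>\<tau>. expands \<eta> t \<rho> \<tau>"
  using assms
proof (induction C arbitrary: \<rho>)
  case (Prim c)
  then show ?case by (auto intro: expands.intros)
next
  case (Meth m)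
  then obtain b where "b \<in> \<eta> m t" by auto
  with Meth.prems(1) show ?case by (auto intro: expands.intros)
next
  case (Seq C1 C2)
  then obtain \<rho>1 \<rho>2 where "\<rho> = \<rho>1 @ \<rho>2" "\<rho>1 \<in> cmd_traces skip_env t C1"
    "\<rho>2 \<in> cmd_traces skip_env t C2" by auto
  with Seq.IH(1)[of \<rho>1] Seq.IH(2)[of \<rho>2] Seq.prems(2) show ?case
    by (fastforce intro: expands_append)
next
  case (Choice C1 C2)
  then show ?case by fastforce
next
  case (Iter C)
  have "\<rho> \<in> iter_traces (cmd_traces skip_env t C)" using Iter.prems by simp
  then show ?case
  proof (induction rule: iter_traces_induct)
    case Nil
    then show ?case by (auto intro: expands.intros)
  next
    case (append \<rho> \<rho>')
    then show ?case using Iter.IH[of \<rho>] Iter.prems(2) by (fastforce intro: expands_append)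
  qed
qed

lemma mgc_tracesE:
  assumes "(t, Call m None) # \<tau> \<in> mgc_traces L t"
  obtains b \<tau>' where "b \<in> lib_env L m t" "\<tau> = b @ (t, Ret m None) # \<tau>'" "\<tau>' \<in> mgc_traces L t"
proof -
  let ?A = "\<Union>m\<in>dom L. cmd_traces (lib_env L) t (Meth m)"
  obtain ts where ts: "(t, Call m None) # \<tau> = concat ts" "set ts \<subseteq> ?A"
    using assms unfolding mgc_traces_def iter_traces_def by blast
  then obtain \<rho> ts' where [simp]: "ts = \<rho> # ts'" by (cases ts) auto
  have "\<rho> \<in> ?A" using ts(2) by simp
  then obtain m' b where \<rho>: "\<rho> = (t, Call m' None) # b @ [(t, Ret m' None)]" and b: "b \<in> lib_env L m' t"
    by auto
  have "m' = m" and \<tau>: "\<tau> = b @ (t, Ret m None) # concat ts'" using ts(1) \<rho> by auto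
  moreover have "concat ts' \<in> mgc_traces L t"
    using ts(2) unfolding mgc_traces_def iter_traces_def by (intro CollectI exI[of _ ts']) simp
  ultimately show thesis using that b by blast
qed

text \<open>Completes one thread of a partial run. Finished blocks of \<open>\<tau>\<close> hold
  genuine bodies because the library projection extends to a trace of the most general client; that
  same trace supplies the rest of a block left open; calls that \<open>\<tau>\<close> has not
  started take their bodies from \<open>\<tau>0\<close>.\<close>

lemma expands_extend:
  assumes "expands (lib_env L) t \<rho> \<tau>0"
    and "client \<tau> @ r = \<rho>" "lib \<tau> @ r' \<in> mgc_traces L t" "\<forall>\<phi>\<in>set \<tau>. fst \<phi> = t"
  shows "\<exists>\<tau>'. expands (lib_env L) t \<rho> (\<tau> @ \<tau>')"
  using assms
proof (induction arbitrary: \<tau> rule: expands.induct)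
  case expands_Nil
  have "\<tau> = []"
  proof (cases \<tau>)
    case (Cons \<phi> \<tau>')
    then show ?thesis
      using client_append_prefix[of "[\<phi>]" \<tau>'] client_snoc[of "[]" \<phi>] expands_Nil by simp
  qed simp
  then show ?case by (auto intro: expands.intros)
next
  case (expands_Exec \<rho> \<tau>0 c)
  show ?case
  proof (cases \<tau>)
    case Nil
    then show ?thesis using expands_Exec.hyps by (auto intro: expands.intros)
  next
    case (Cons \<phi> \<tau>')
    then have "\<phi> = (t, Exec c)"
      using client_append_prefix[of "[\<phi>]" \<tau>'] client_snoc[of "[]" \<phi>] expands_Exec.prems(1) by auto
    with Cons expands_Exec.prems have "client \<tau>' @ r = \<rho>" "lib \<tau>' @ r' \<in> mgc_traces L t"
      "\<forall>\<phi>\<in>set \<tau>'. fst \<phi> = t"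
      by (auto simp: client_Exec_Cons lib_Exec_Cons)
    from expands_Exec.IH[OF this] show ?thesis
      using Cons \<open>\<phi> = (t, Exec c)\<close> by (auto intro: expands.intros)
  qed
next
  case (expands_Call b0 m \<rho> \<tau>0)
  show ?case
  proof (cases \<tau>)
    case Nil
    then show ?thesis
      using expands.expands_Call[OF expands_Call.hyps] by auto
  next
    case (Cons \<phi> \<tau>')
    then have \<phi>: "\<phi> = (t, Call m None)"
      using client_append_prefix[of "[\<phi>]" \<tau>'] client_snoc[of "[]" \<phi>] expands_Call.prems(1) by auto
    define e where "e = takeWhile is_exec \<tau>'"
    define s where "s = dropWhile is_exec \<tau>'"
    have \<tau>': "\<tau>' = e @ s" by (simp add: e_def s_def)
    have "execs_of t e"
      using expands_Call.prems(3) Cons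
      by (auto simp: execs_of_def e_def dest: set_takeWhileD)
    note e = open_call_projections[OF this] closed_call_projections[OF this]
    show ?thesis
    proof (cases s)
      case Nil
      \<comment> \<open>The call is still open at the end of \<open>\<tau>\<close>, so
        \<open>e\<close> is only the part of the body executed so far. The first return of
        \<open>e @ r'\<close> lies beyond \<open>e\<close>, hence the body \<open>b\<close> found
        there extends \<open>e\<close>.\<close>
      with \<tau>' Cons \<phi> expands_Call.prems(2) e have "(t, Call m None) # e @ r' \<in> mgc_traces L t" by simp
      then obtain b \<tau>1 where b: "b \<in> lib_env L m t" "e @ r' = b @ (t, Ret m None) # \<tau>1"
        by (rule mgc_tracesE)
      from b(2) \<open>execs_of t e\<close> obtain b' where "b = e @ b'"
        by (auto simp: append_eq_append_conv2 append_eq_Cons_conv execs_of_def)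
      with b expands.expands_Call[of b "lib_env L" m t \<rho> \<tau>0] expands_Call.hyps show ?thesis
        using Cons \<phi> \<tau>' \<open>s = []\<close> by auto
    next
      case s: (Cons \<psi> s')
      have "\<not> is_exec \<psi>" using s hd_dropWhile[of is_exec \<tau>'] by (simp add: s_def)
      have \<tau>: "\<tau> = ((t, Call m None) # e @ [\<psi>]) @ s'" using Cons \<phi> \<tau>' s by simp
      have "client ((t, Call m None) # e @ [\<psi>]) = [(t, Call m None), \<psi>]"
        using client_snoc[of "(t, Call m None) # e" \<psi>] e \<open>\<not> is_exec \<psi>\<close> by simp
      then have \<psi>: "\<psi> = (t, Ret m None)"
        using client_append_prefix[of "(t, Call m None) # e @ [\<psi>]" s'] expands_Call.prems(1) \<tau> by auto
      note cl = client_append[of "(t, Call m None) # e @ [\<psi>]" s']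
        and lb = lib_append[of "(t, Call m None) # e @ [\<psi>]" s']
      have 1: "client s' @ r = \<rho>"
        using expands_Call.prems(1) cl e unfolding \<tau> \<psi> by simp
      have "(t, Call m None) # e @ (t, Ret m None) # lib s' @ r' \<in> mgc_traces L t"
        using expands_Call.prems(2) lb e unfolding \<tau> \<psi> by simp
      then obtain b \<tau>1 where b: "b \<in> lib_env L m t" "\<tau>1 \<in> mgc_traces L t"
        "e @ (t, Ret m None) # lib s' @ r' = b @ (t, Ret m None) # \<tau>1"
        by (rule mgc_tracesE)
      \<comment> \<open>Both \<open>b\<close> and \<open>e\<close> consist of commands only, so the
        return following each is the first one in the list.\<close>
      have "b = e \<and> \<tau>1 = lib s' @ r'"
        using b(3) \<open>execs_of t e\<close> lib_env_execs[OF b(1)]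
        by (auto simp: append_eq_append_conv2 append_eq_Cons_conv Cons_eq_append_conv execs_of_def)
      with b have "e \<in> lib_env L m t" "lib s' @ r' \<in> mgc_traces L t" by auto
      moreover from expands_Call.IH[OF 1 this(2)] obtain \<tau>2 where "expands (lib_env L) t \<rho> (s' @ \<tau>2)"
        using expands_Call.prems(3) \<tau> by auto
      ultimately show ?thesis
        using expands.expands_Call[of e "lib_env L" m t \<rho> "s' @ \<tau>2"] \<tau> \<psi> by auto
    qed
  qed
qed

lemma cmd_traces_thread:
  assumes "\<tau> \<in> cmd_traces \<eta> t C" "\<And>m b. b \<in> \<eta> m t \<Longrightarrow> \<forall>\<phi>\<in>set b. fst \<phi> = t"
  shows "\<forall>\<phi>\<in>set \<tau>. fst \<phi> = t"
  using assms(1)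
proof (induction C arbitrary: \<tau>)
  case (Meth m)
  then show ?case using assms(2) by fastforce
next
  case (Iter C)
  have "\<tau> \<in> iter_traces (cmd_traces \<eta> t C)" using Iter.prems by simp
  then show ?case using Iter.IH by (induction rule: iter_traces_induct) auto
qed fastforce+

lemma thread_proj_concat:
  assumes "\<And>t. t \<in> {1..n} \<Longrightarrow> \<forall>\<phi>\<in>set (\<rho> t). fst \<phi> = t"
  shows "thread_proj t (concat (map \<rho> [1..<Suc n])) = (if t \<in> {1..n} then \<rho> t else [])"
  using assms
proof (induction n)
  case (Suc n)
  have "thread_proj t (\<rho> (Suc n)) = (if t = Suc n then \<rho> t else [])"
    using Suc.prems[of "Suc n"] by (auto simp: filter_id_conv filter_empty_conv)
  then show ?case using Suc.IH Suc.prems by auto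
qed simp

text \<open>The converse of the decomposition. The library projection is compared with
  \<open>\<tau>l\<close> only thread by thread, which suffices because parallel trace sets admit
  every interleaving; this is what lets the merged trace order its calls and returns differently
  from the library run.\<close>

lemma client_traces_composition:
  fixes \<tau> :: "('c, 'm, 's::separation_algebra) trace"
  assumes "client \<tau> \<in> traces (SpecClient \<Gamma> Cs)" "\<tau>l \<in> traces (SpecLib L \<Gamma>)"
    and proj: "\<And>t. thread_proj t (lib \<tau>) = thread_proj t \<tau>l"
    and "wf_library L" "complete_for Cs L"
  shows "\<tau> \<in> traces (Complete Cs L)"
proof -
  let ?n = "length Cs"
  obtain r where "client \<tau> @ r \<in> client_traces skip_env Cs"
    using assms(1) by (auto simp: prefix_closure_def)
  then have thr: "\<forall>\<phi>\<in>set (client \<tau>). fst \<phi> \<in> {1..?n}"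
    and loc: "\<And>t. t \<in> {1..?n} \<Longrightarrow>
      thread_proj t (client \<tau> @ r) \<in> cmd_traces skip_env t (Cs ! (t - 1))"
    by (auto simp: client_traces_def par_traces_def)
  obtain k r' where k: "\<tau>l @ r' \<in> par_traces k (mgc_traces L)"
    using assms(2) by (auto simp: prefix_closure_def)
  have mgc: "thread_proj t (\<tau>l @ r') \<in> mgc_traces L t" for t
  proof (cases "t \<in> {1..k}")
    case True
    then show ?thesis using k by (auto simp: par_traces_def)
  next
    case False
    then have "thread_proj t (\<tau>l @ r') = []" using k by (auto simp: par_traces_def filter_empty_conv)
    then show ?thesis by (simp only: mgc_traces_def iter_traces_Nil)
  qed
  have "\<exists>\<rho>. thread_proj t \<tau> @ \<rho> \<in> cmd_traces (lib_env L) t (Cs ! (t - 1))" if t: "t \<in> {1..?n}" for t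
  proof -
    have in_Cs: "Cs ! (t - 1) \<in> set Cs" using t by auto
    have ne: "(lib_env L :: ('c, 'm, 's) method_env) m t \<noteq> {}" if "m \<in> methods_of (Cs ! (t - 1))" for m
    proof (rule lib_env_nonempty[OF assms(4)])
      show "m \<in> dom L"
        using in_Cs assms(5) that unfolding complete_for_def by blast
    qed
    \<comment> \<open>An arbitrary completed run, not related to \<open>\<tau>\<close>; its bodies
      serve only for calls that \<open>\<tau>\<close> has not started.\<close>
    obtain \<tau>0 where "expands (lib_env L) t (thread_proj t (client \<tau> @ r)) \<tau>0"
      using expands_exists[where \<eta> = "lib_env L", OF loc[OF t] ne] by blast
    moreover have "client (thread_proj t \<tau>) @ thread_proj t r = thread_proj t (client \<tau> @ r)"
      by (simp add: thread_proj_client)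
    moreover have "lib (thread_proj t \<tau>) @ thread_proj t r' \<in> mgc_traces L t"
      using mgc[of t] proj[of t] by (simp flip: thread_proj_lib)
    moreover have "\<forall>\<phi>\<in>set (thread_proj t \<tau>). fst \<phi> = t" by simp
    ultimately obtain \<rho>
      where "expands (lib_env L) t (thread_proj t (client \<tau> @ r)) (thread_proj t \<tau> @ \<rho>)"
      using expands_extend by blast
    from expands_cmd_traces[OF loc[OF t] this] show ?thesis by blast
  qed
  then obtain \<rho> where \<rho>: "\<And>t. t \<in> {1..?n} \<Longrightarrow>
      thread_proj t \<tau> @ \<rho> t \<in> cmd_traces (lib_env L) t (Cs ! (t - 1))" by metis
  have \<rho>_thr: "\<forall>\<phi>\<in>set (\<rho> t). fst \<phi> = t" if "t \<in> {1..?n}" for t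
    using cmd_traces_thread[OF \<rho>[OF that]] lib_env_execs[of _ L _ t] by (auto simp: execs_of_def)
  \<comment> \<open>The per-thread completions can be appended one thread after the other, since any
    interleaving is allowed.\<close>
  have "\<tau> @ concat (map \<rho> [1..<Suc ?n]) \<in> client_traces (lib_env L) Cs"
    unfolding client_traces_def par_traces_def
  proof (intro CollectI conjI ballI)
    fix \<phi> assume "\<phi> \<in> set (\<tau> @ concat (map \<rho> [1..<Suc ?n]))"
    then consider "\<phi> \<in> set \<tau>" | t where "t \<in> {1..?n}" "\<phi> \<in> set (\<rho> t)" by fastforce
    then show "fst \<phi> \<in> {1..?n}"
    proof cases
      case 1
      then have "fst \<phi> \<in> fst ` set (client \<tau>)" by (simp add: fst_client)
      then show ?thesis using thr by auto
    next
      case 2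
      then show ?thesis using \<rho>_thr by auto
    qed
  next
    fix t assume t: "t \<in> {1..?n}"
    then show "thread_proj t (\<tau> @ concat (map \<rho> [1..<Suc ?n])) \<in> cmd_traces (lib_env L) t (Cs ! (t - 1))"
      using \<rho>[OF t] thread_proj_concat[of ?n \<rho> t, OF \<rho>_thr] by (simp del: upt_Suc)
  qed
  then show ?thesis by (auto simp: prefix_closure_def simp del: upt_Suc)
qed

section \<open>Well-bracketing and annotations\<close>

text \<open>Bodies are empty in a client-local trace, so the next action of a thread with an open
  call must be its return.\<close>

definition client_wf :: "('c, 'm, 's) trace \<Rightarrow> bool" where
  "client_wf \<tau> \<longleftrightarrow> (\<forall>\<rho> \<phi> \<rho>'. \<tau> = \<rho> @ \<phi> # \<rho>' \<longrightarrow> (is_ret \<phi> \<longleftrightarrow> in_call (fst \<phi>) \<rho>))"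

text \<open>The dual discipline: outside its method bodies a thread of the most general client does
  nothing but call.\<close>

definition lib_wf :: "('c, 'm, 's) trace \<Rightarrow> bool" where
  "lib_wf \<tau> \<longleftrightarrow> (\<forall>\<rho> \<phi> \<rho>'. \<tau> = \<rho> @ \<phi> # \<rho>' \<longrightarrow> (is_call \<phi> \<longleftrightarrow> \<not> in_call (fst \<phi>) \<rho>))"

lemma par_traces_thread: "\<tau> \<in> par_traces n S \<Longrightarrow> \<phi> \<in> set \<tau> \<Longrightarrow> thread_proj (fst \<phi>) \<tau> \<in> S (fst \<phi>)"
  by (auto simp: par_traces_def)

lemma expands_in_call:
  assumes "expands \<eta> t \<rho> \<tau>" "\<rho> = \<rho>1 @ \<phi> # \<rho>2"
  shows "is_ret \<phi> \<longleftrightarrow> in_call t \<rho>1"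
  using assms
proof (induction arbitrary: \<rho>1 rule: expands.induct)
  case (expands_Exec \<rho> \<tau> c)
  show ?case
  proof (cases \<rho>1)
    case (Cons \<psi> \<rho>1')
    with expands_Exec show ?thesis by (auto simp: in_call_def thread_history_def)
  qed (use expands_Exec in auto)
next
  case (expands_Call b m \<rho> \<tau>)
  show ?case
  proof (cases \<rho>1)
    case (Cons \<psi> \<rho>1')
    note \<psi> = this
    show ?thesis
    proof (cases \<rho>1')
      case (Cons \<psi>' \<rho>1'')
      with \<psi> expands_Call have "\<rho>1 = [(t, Call m None), (t, Ret m None)] @ \<rho>1''"
        "is_ret \<phi> \<longleftrightarrow> in_call t \<rho>1''" by auto
      then show ?thesis
        using in_call_append_not[of t "[(t, Call m None), (t, Ret m None)]" \<rho>1'']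
        by (simp add: in_call_def[of t "[_, _]"] thread_history_def[of t "[_, _]"])
    qed (use \<psi> expands_Call in \<open>auto simp: in_call_def thread_history_def\<close>)
  qed (use expands_Call in auto)
qed simp

lemma traces_SpecClient_wf:
  assumes "\<tau> \<in> traces (SpecClient \<Gamma> Cs)"
  shows "client_wf \<tau>"
  unfolding client_wf_def
proof (intro allI impI)
  fix \<rho> \<phi> \<rho>' assume \<tau>: "\<tau> = \<rho> @ \<phi> # \<rho>'"
  let ?t = "fst \<phi>"
  obtain r where "\<tau> @ r \<in> client_traces skip_env Cs"
    using assms by (auto simp: prefix_closure_def)
  then have "thread_proj ?t (\<tau> @ r) \<in> cmd_traces skip_env ?t (Cs ! (?t - 1))"
    unfolding client_traces_def by (rule par_traces_thread) (simp add: \<tau>)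
  \<comment> \<open>Filling every block with the empty body serves only to expose the call-return
    shape of the trace.\<close>
  from expands_exists[OF this, of skip_env] obtain \<tau>0 where
    "expands skip_env ?t (thread_proj ?t (\<tau> @ r)) \<tau>0" by auto
  then have "is_ret \<phi> \<longleftrightarrow> in_call ?t (thread_proj ?t \<rho>)"
    by (rule expands_in_call) (simp add: \<tau>)
  then show "is_ret \<phi> \<longleftrightarrow> in_call ?t \<rho>"
    by (simp add: in_call_def)
qed

lemma mgc_traces_in_call:
  assumes "\<tau> \<in> mgc_traces L t" "\<tau> = \<rho>1 @ \<phi> # \<rho>2"
  shows "is_call \<phi> \<longleftrightarrow> \<not> in_call t \<rho>1"
  using assms unfolding mgc_traces_def
proof (induction arbitrary: \<rho>1 rule: iter_traces_induct)
  case (append \<rho> \<rho>')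
  then obtain m b where \<rho>: "\<rho> = (t, Call m None) # b @ [(t, Ret m None)]" and b: "b \<in> lib_env L m t"
    by auto
  note ex = lib_env_execs[OF b]
  show ?case
  proof (cases "length \<rho> \<le> length \<rho>1")
    case True
    then obtain \<rho>1' where "\<rho>1 = \<rho> @ \<rho>1'" "\<rho>' = \<rho>1' @ \<phi> # \<rho>2"
      using append.prems by (metis append_eq_append_conv_if append_take_drop_id)
    then show ?thesis
      using append.IH in_call_append_not[of t \<rho> \<rho>1'] closed_call_projections(3)[OF ex] \<rho> by simp
  next
    case False
    then have eq: "\<rho> = \<rho>1 @ \<phi> # drop (Suc (length \<rho>1)) \<rho>"
      using append.prems
      by (metis append_eq_append_conv_if id_take_nth_drop le_eq_less_or_eq linorder_not_less nth_append nth_append_length)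
    show ?thesis
    proof (cases \<rho>1)
      case Nil
      then show ?thesis using eq \<rho> by auto
    next
      case (Cons \<psi> \<rho>1')
      then obtain r where "b @ [(t, Ret m None)] = \<rho>1' @ \<phi> # r" "\<psi> = (t, Call m None)"
        using eq \<rho> by auto
      then have "execs_of t \<rho>1' \<and> \<not> is_call \<phi>"
        using ex not_is_exec[of \<phi>]
        by (auto simp: append_eq_append_conv2 append_eq_Cons_conv Cons_eq_append_conv execs_of_def)
      then show ?thesis
        using open_call_projections(3)[of t \<rho>1'] Cons \<open>\<psi> = _\<close> by auto
    qed
  qed
qed simp

lemma traces_SpecLib_wf:
  assumes "\<tau> \<in> traces (SpecLib L \<Gamma>)"
  shows "lib_wf \<tau>"
  unfolding lib_wf_def
proof (intro allI impI)
  fix \<rho> \<phi> \<rho>' assume \<tau>: "\<tau> = \<rho> @ \<phi> # \<rho>'"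
  let ?t = "fst \<phi>"
  obtain r k where "\<tau> @ r \<in> par_traces k (mgc_traces L)"
    using assms by (auto simp: prefix_closure_def)
  then have "thread_proj ?t (\<tau> @ r) \<in> mgc_traces L ?t"
    by (rule par_traces_thread) (simp add: \<tau>)
  then have "is_call \<phi> \<longleftrightarrow> \<not> in_call ?t (thread_proj ?t \<rho>)"
    by (rule mgc_traces_in_call) (simp add: \<tau>)
  then show "is_call \<phi> \<longleftrightarrow> \<not> in_call ?t \<rho>"
    by (simp add: in_call_def)
qed

section \<open>Erasure of annotations\<close>

fun ground_action :: "('c, 'm, 's) action \<Rightarrow> ('c, 'm, 's) action" where
  "ground_action (t, Exec c) = (t, Exec c)"
| "ground_action (t, Call m a) = (t, Call m None)"
| "ground_action (t, Ret m a) = (t, Ret m None)"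

abbreviation ground :: "('c, 'm, 's) trace \<Rightarrow> ('c, 'm, 's) trace" where
  "ground \<equiv> map ground_action"

lemma ground_action_simps [simp]:
  "fst (ground_action \<phi>) = fst \<phi>" "is_exec (ground_action \<phi>) \<longleftrightarrow> is_exec \<phi>"
  "is_call (ground_action \<phi>) \<longleftrightarrow> is_call \<phi>" "is_ret (ground_action \<phi>) \<longleftrightarrow> is_ret \<phi>"
  by (cases \<phi> rule: action_cases; simp)+

lemma thread_history_ground: "thread_history t (ground \<tau>) = ground (thread_history t \<tau>)"
  by (simp add: thread_history_def filter_map comp_def)

lemma thread_proj_ground: "thread_proj t (ground \<tau>) = ground (thread_proj t \<tau>)"
  by (simp add: filter_map comp_def)

lemma in_call_ground [simp]: "in_call t (ground \<tau>) \<longleftrightarrow> in_call t \<tau>"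
  by (auto simp: in_call_def thread_history_ground last_map)

lemma client_ground: "client (ground \<tau>) = ground (client \<tau>)"
  by (induction \<tau> rule: rev_induct) (auto simp: client_snoc)

lemma lib_ground: "lib (ground \<tau>) = ground (lib \<tau>)"
  by (induction \<tau> rule: rev_induct) (auto simp: lib_snoc)

lemma client_wf_ground: "client_wf (ground \<tau>) \<Longrightarrow> client_wf \<tau>"
  unfolding client_wf_def by (metis (no_types, lifting) ground_action_simps(1,4) in_call_ground list.map(2) map_append)

lemma lib_wf_ground: "lib_wf (ground \<tau>) \<Longrightarrow> lib_wf \<tau>"
  unfolding lib_wf_def by (metis (no_types, lifting) ground_action_simps(1,3) in_call_ground list.map(2) map_append)

lemma cmd_traces_ground:
  assumes "\<tau> \<in> cmd_traces \<eta> t C" "\<And>m b. b \<in> \<eta> m t \<Longrightarrow> ground b = b"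
  shows "ground \<tau> = \<tau>"
  using assms(1)
proof (induction C arbitrary: \<tau>)
  case (Iter C)
  have "\<tau> \<in> iter_traces (cmd_traces \<eta> t C)" using Iter.prems by simp
  then show ?case using Iter.IH by (induction rule: iter_traces_induct) auto
qed (use assms(2) in auto)

lemma execs_of_ground: "execs_of t b \<Longrightarrow> ground b = b"
  unfolding execs_of_def
  by (intro map_idI) (metis action_cases ground_action.simps(1) act_kind_simps(2,3))

lemma par_traces_ground:
  assumes "\<tau> @ \<tau>' \<in> par_traces n S" "\<And>t \<rho>. \<rho> \<in> S t \<Longrightarrow> ground \<rho> = \<rho>"
  shows "ground \<tau> = \<tau>"
proof (rule map_idI)
  fix \<phi> assume "\<phi> \<in> set \<tau>"
  then have "\<phi> \<in> set (thread_proj (fst \<phi>) (\<tau> @ \<tau>'))"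
    "thread_proj (fst \<phi>) (\<tau> @ \<tau>') \<in> S (fst \<phi>)"
    using par_traces_thread[OF assms(1), of \<phi>] by auto
  then show "ground_action \<phi> = \<phi>"
    using assms(2) map_eq_conv[of ground_action _ id] by (metis id_apply list.map_id)
qed

text \<open>Annotations arise only during evaluation. Erasing those of a run therefore gives back
  the very trace that was evaluated, which transfers membership in trace sets and well-bracketing to
  annotated traces.\<close>

lemma traces_ground:
  assumes "\<tau> \<in> traces P"
  shows "ground \<tau> = \<tau>"
proof (cases P)
  case (Complete Cs L)
  with assms obtain \<tau>' where
    "\<tau> @ \<tau>' \<in> par_traces (length Cs) (\<lambda>t. cmd_traces (lib_env L) t (Cs ! (t - 1)))"
    by (auto simp: prefix_closure_def client_traces_def)
  then show ?thesis
    by (rule par_traces_ground) (auto intro: cmd_traces_ground execs_of_ground[OF lib_env_execs])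
next
  case (SpecLib L \<Gamma>)
  with assms obtain \<tau>' k where "\<tau> @ \<tau>' \<in> par_traces k (mgc_traces L)"
    by (auto simp: prefix_closure_def)
  then show ?thesis
  proof (rule par_traces_ground)
    fix t \<rho> assume "\<rho> \<in> (mgc_traces L t :: ('a, 'b, 'c) trace set)"
    then show "ground \<rho> = \<rho>"
      unfolding mgc_traces_def
      by (induction rule: iter_traces_induct) (auto dest: execs_of_ground[OF lib_env_execs])
  qed
next
  case (SpecClient \<Gamma> Cs)
  with assms obtain \<tau>' where
    "\<tau> @ \<tau>' \<in> par_traces (length Cs) (\<lambda>t. cmd_traces skip_env t (Cs ! (t - 1)))"
    by (auto simp: prefix_closure_def client_traces_def)
  then show ?thesis
    by (rule par_traces_ground) (auto intro: cmd_traces_ground)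
qed

section \<open>Evaluation\<close>

text \<open>A single fault-free path through the set-valued evaluation. It may exist even if
  \<open>eval_trace\<close> yields \<open>Fault\<close> because of another path.\<close>

inductive eval_run ::
    "('c, 's::separation_algebra) transformer \<Rightarrow> ('c, 'm, 's) program \<Rightarrow> 's \<Rightarrow>
     ('c, 'm, 's) trace \<Rightarrow> 's \<Rightarrow> ('c, 'm, 's) trace \<Rightarrow> bool"
  for f P \<sigma> where
  eval_run_Nil: "eval_run f P \<sigma> [] \<sigma> []"
| eval_run_snoc: "eval_run f P \<sigma> \<tau> \<sigma>' \<tau>' \<Longrightarrow> step f P \<phi> \<sigma>' = Outcomes B \<Longrightarrow> (\<sigma>'', \<phi>') \<in> B \<Longrightarrow>
    eval_run f P \<sigma> (\<tau> @ [\<phi>]) \<sigma>'' (\<tau>' @ [\<phi>'])"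

lemma eval_run_NilD: "eval_run f P \<sigma> [] \<sigma>' \<tau>' \<Longrightarrow> \<sigma>' = \<sigma> \<and> \<tau>' = []"
  by (erule eval_run.cases) auto

lemma eval_run_snocE:
  assumes "eval_run f P \<sigma> (\<tau> @ [\<phi>]) \<sigma>'' \<tau>''"
  obtains \<sigma>' \<tau>' \<phi>' B where "eval_run f P \<sigma> \<tau> \<sigma>' \<tau>'" "step f P \<phi> \<sigma>' = Outcomes B" "(\<sigma>'', \<phi>') \<in> B"
    "\<tau>'' = \<tau>' @ [\<phi>']"
  using assms by (cases rule: eval_run.cases) auto

lemma eval_trace_snoc: "eval_trace f P \<sigma> (\<tau> @ [\<phi>]) = extend f P (eval_trace f P \<sigma> \<tau>) \<phi>"
  by (simp add: eval_trace_def)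

lemma eval_trace_Outcomes:
  "eval_trace f P \<sigma> \<tau> = Outcomes A \<Longrightarrow> (\<sigma>', \<tau>') \<in> A \<longleftrightarrow> eval_run f P \<sigma> \<tau> \<sigma>' \<tau>'"
proof (induction \<tau> arbitrary: A \<sigma>' \<tau>' rule: rev_induct)
  case Nil
  then show ?case by (auto simp: eval_trace_def intro: eval_run.intros dest: eval_run_NilD)
next
  case (snoc \<phi> \<tau>)
  then obtain A0 where A0: "eval_trace f P \<sigma> \<tau> = Outcomes A0"
    and A: "A = {(\<sigma>'', \<tau>' @ [\<phi>']) | \<sigma>'' \<tau>' \<phi>'.
      \<exists>\<sigma>' B. (\<sigma>', \<tau>') \<in> A0 \<and> step f P \<phi> \<sigma>' = Outcomes B \<and> (\<sigma>'', \<phi>') \<in> B}"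
    by (auto simp: eval_trace_snoc extend_def split: faulting.splits if_splits)
  show ?case
  proof
    assume "(\<sigma>', \<tau>') \<in> A"
    then show "eval_run f P \<sigma> (\<tau> @ [\<phi>]) \<sigma>' \<tau>'"
      unfolding A using snoc.IH[OF A0] by (auto intro: eval_run.intros)
  next
    assume "eval_run f P \<sigma> (\<tau> @ [\<phi>]) \<sigma>' \<tau>'"
    then show "(\<sigma>', \<tau>') \<in> A"
      unfolding A using snoc.IH[OF A0] by (elim eval_run_snocE) blast
  qed
qed

lemma eval_trace_snoc_Fault:
  assumes "eval_run f P \<sigma> \<tau> \<sigma>' \<tau>'" "step f P \<phi> \<sigma>' = Fault"
  shows "eval_trace f P \<sigma> (\<tau> @ [\<phi>]) = Fault"
proof (cases "eval_trace f P \<sigma> \<tau>")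
  case (Outcomes A)
  then have "(\<sigma>', \<tau>') \<in> A" using eval_trace_Outcomes assms(1) by blast
  then show ?thesis using assms(2) Outcomes by (auto simp: eval_trace_snoc extend_def)
qed (simp add: eval_trace_snoc extend_def)

lemma eval_trace_FaultD:
  "eval_trace f P \<sigma> \<tau> = Fault \<Longrightarrow>
   \<exists>\<rho> \<phi> r \<sigma>' \<rho>'. \<tau> = \<rho> @ \<phi> # r \<and> eval_run f P \<sigma> \<rho> \<sigma>' \<rho>' \<and> step f P \<phi> \<sigma>' = Fault"
proof (induction \<tau> rule: rev_induct)
  case Nil
  then show ?case by (simp add: eval_trace_def)
next
  case (snoc \<phi> \<tau>)
  show ?case
  proof (cases "eval_trace f P \<sigma> \<tau>")
    case Fault
    from snoc.IH[OF this] show ?thesis by (metis append.assoc append_Cons)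
  next
    case (Outcomes A)
    with snoc.prems obtain \<sigma>' \<tau>' where "(\<sigma>', \<tau>') \<in> A" "step f P \<phi> \<sigma>' = Fault"
      by (auto simp: eval_trace_snoc extend_def split: if_splits)
    then show ?thesis using eval_trace_Outcomes[OF Outcomes] by blast
  qed
qed

lemma traces_prefix: "\<tau> @ \<tau>' \<in> traces P \<Longrightarrow> \<tau> \<in> traces P"
  by (cases P) (auto simp: prefix_closure_def)

text \<open>Trace sets are prefix closed, so the trace up to and including the first faulting action
  is itself a trace of the program; safety thus concerns one further action from each reachable
  state.\<close>

lemma safe_iff:
  "safe f P I \<longleftrightarrow> (\<forall>\<sigma>\<in>I. \<forall>\<tau> \<phi> \<sigma>' \<tau>'. \<tau> @ [\<phi>] \<in> traces P \<longrightarrow> eval_run f P \<sigma> \<tau> \<sigma>' \<tau>' \<longrightarrow>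
     step f P \<phi> \<sigma>' \<noteq> Fault)" (is "_ \<longleftrightarrow> ?r")
proof
  assume "safe f P I"
  then show ?r using eval_trace_snoc_Fault by (fastforce simp: safe_def denot_def split: if_splits)
next
  assume ?r
  then have "eval_trace f P \<sigma> \<tau> \<noteq> Fault" if "\<sigma> \<in> I" "\<tau> \<in> traces P" for \<sigma> \<tau>
    using that eval_trace_FaultD[of f P \<sigma> \<tau>] traces_prefix[of "_ @ [_]" _ P] by fastforce
  then show "safe f P I" by (auto simp: safe_def denot_def)
qed

lemma safe_stepE:
  assumes "safe f P I" "\<sigma> \<in> I" "\<tau> @ [\<phi>] \<in> traces P" "eval_run f P \<sigma> \<tau> \<sigma>' \<tau>'"
  obtains B where "step f P \<phi> \<sigma>' = Outcomes B"
  using assms unfolding safe_iff by (cases "step f P \<phi> \<sigma>'") blast+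

lemma mem_denot_from:
  assumes "safe f P I"
  shows "(\<sigma>, \<tau>') \<in> denot_from f P I \<longleftrightarrow>
    \<sigma> \<in> I \<and> (\<exists>\<tau>\<in>traces P. \<exists>\<sigma>'. eval_run f P \<sigma> \<tau> \<sigma>' \<tau>')"
proof (cases "\<sigma> \<in> I")
  case True
  then have nf: "eval_trace f P \<sigma> \<tau> \<noteq> Fault" if "\<tau> \<in> traces P" for \<tau>
    using assms that by (auto simp: safe_def denot_def split: if_splits)
  have "(\<exists>A. eval_trace f P \<sigma> \<tau> = Outcomes A \<and> (\<sigma>', \<tau>') \<in> A) \<longleftrightarrow> eval_run f P \<sigma> \<tau> \<sigma>' \<tau>'"
    if "\<tau> \<in> traces P" for \<tau> \<sigma>'
    using nf[OF that] eval_trace_Outcomes[of f P \<sigma> \<tau>] by (cases "eval_trace f P \<sigma> \<tau>") auto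
  then show ?thesis
    using True nf by (auto simp: denot_from_def denot_def) blast+
qed (simp add: denot_from_def)

lemma step_ground:
  assumes "step f P \<phi> \<sigma> = Outcomes B" "(\<sigma>', \<phi>') \<in> B"
  shows "ground_action \<phi>' = ground_action \<phi>"
  using assms by (cases \<phi> rule: action_cases; cases P) (auto split: faulting.splits option.splits)

lemma eval_run_ground: "eval_run f P \<sigma> \<tau> \<sigma>' \<tau>' \<Longrightarrow> ground \<tau>' = ground \<tau>"
  by (induction rule: eval_run.induct) (auto dest: step_ground)

lemma eval_run_Complete: "eval_run f (Complete Cs L) \<sigma> \<tau> \<sigma>' \<tau>' \<Longrightarrow> \<tau>' = \<tau>"
proof (induction rule: eval_run.induct)
  case (eval_run_snoc \<tau> \<sigma>' \<tau>' \<phi> B \<sigma>'' \<phi>')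
  then show ?case by (cases \<phi> rule: action_cases) (auto split: faulting.splits)
qed simp

text \<open>Precision determines the substate and cancellation the remainder, so the definite
  description denotes an actual splitting.\<close>

lemma split_pred_SomeD:
  assumes "precise r" "split_pred \<sigma> r = Some (a, b)"
  shows "a \<in> r" "a \<star> b = Some \<sigma>"
proof -
  obtain a' b' where ab': "a' \<in> r" "a' \<star> b' = Some \<sigma>"
    and eq: "(a, b) = (THE (x, y). x \<in> r \<and> x \<star> y = Some \<sigma>)"
    using assms(2) by (auto simp: split_pred_def split: if_splits)
  have "(THE (x, y). x \<in> r \<and> x \<star> y = Some \<sigma>) = (a', b')"
  proof (rule the_equality)
    show "case (a', b') of (x, y) \<Rightarrow> x \<in> r \<and> x \<star> y = Some \<sigma>" using ab' by simp
    show "z = (a', b')" if z0: "case z of (x, y) \<Rightarrow> x \<in> r \<and> x \<star> y = Some \<sigma>" for z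
    proof -
      obtain x y where z: "z = (x, y)" "x \<in> r" "x \<star> y = Some \<sigma>" using z0 by (cases z) auto
      then have "x = a'" using assms(1) ab' unfolding precise_def by blast
      then show ?thesis using z ab'(2) sep_cancel by blast
    qed
  qed
  with eq ab' show "a \<in> r" "a \<star> b = Some \<sigma>" by auto
qed

section \<open>Runs as paths over annotated actions\<close>

definition exec_step where
  "exec_step f \<phi> \<sigma> \<sigma>' \<longleftrightarrow> (\<exists>t c A. \<phi> = (t, Exec c) \<and> f t c \<sigma> = Outcomes A \<and> \<sigma>' \<in> A)"

text \<open>Methods without a specification transfer the unit.\<close>

fun transferred :: "('c, 'm, 's::separation_algebra) action \<Rightarrow> 's" where
  "transferred (t, Call m (Some \<sigma>)) = \<sigma>"
| "transferred (t, Ret m (Some \<sigma>)) = \<sigma>"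
| "transferred _ = sep_unit"

text \<open>Once the transferred state is recorded in the action, specification and program can be
  forgotten: a transfer is a plain equation between states. The next two relations follow the same
  pattern for the library and for the complete program.\<close>

definition client_step ::
    "('c, 's::separation_algebra) transformer \<Rightarrow> ('c, 'm, 's) action \<Rightarrow> 's \<Rightarrow> 's \<Rightarrow> bool" where
  "client_step f \<phi> \<sigma> \<sigma>' \<longleftrightarrow> exec_step f \<phi> \<sigma> \<sigma>' \<or> is_call \<phi> \<and> \<sigma>' \<star> transferred \<phi> = Some \<sigma> \<or>
     is_ret \<phi> \<and> \<sigma> \<star> transferred \<phi> = Some \<sigma>'"

definition lib_step ::
    "('c, 's::separation_algebra) transformer \<Rightarrow> ('c, 'm, 's) action \<Rightarrow> 's \<Rightarrow> 's \<Rightarrow> bool" where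
  "lib_step f \<phi> \<sigma> \<sigma>' \<longleftrightarrow> exec_step f \<phi> \<sigma> \<sigma>' \<or> is_call \<phi> \<and> \<sigma> \<star> transferred \<phi> = Some \<sigma>' \<or>
     is_ret \<phi> \<and> \<sigma>' \<star> transferred \<phi> = Some \<sigma>"

definition global_step ::
    "('c, 's::separation_algebra) transformer \<Rightarrow> ('c, 'm, 's) action \<Rightarrow> 's \<Rightarrow> 's \<Rightarrow> bool" where
  "global_step f \<phi> \<sigma> \<sigma>' \<longleftrightarrow> exec_step f \<phi> \<sigma> \<sigma>' \<or> \<not> is_exec \<phi> \<and> \<sigma>' = \<sigma>"

inductive path :: "('a \<Rightarrow> 's \<Rightarrow> 's \<Rightarrow> bool) \<Rightarrow> 's \<Rightarrow> 'a list \<Rightarrow> 's \<Rightarrow> bool" for R \<sigma> where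
  path_Nil: "path R \<sigma> [] \<sigma>"
| path_snoc: "path R \<sigma> \<tau> \<sigma>' \<Longrightarrow> R \<phi> \<sigma>' \<sigma>'' \<Longrightarrow> path R \<sigma> (\<tau> @ [\<phi>]) \<sigma>''"

lemma path_Nil_iff [simp]: "path R \<sigma> [] \<sigma>' \<longleftrightarrow> \<sigma>' = \<sigma>"
  by (auto intro: path.intros elim: path.cases)

lemma path_snoc_iff: "path R \<sigma> (\<tau> @ [\<phi>]) \<sigma>'' \<longleftrightarrow> (\<exists>\<sigma>'. path R \<sigma> \<tau> \<sigma>' \<and> R \<phi> \<sigma>' \<sigma>'')"
  by (auto intro: path.intros elim: path.cases)

lemma path_append: "path R \<sigma> (\<tau> @ \<tau>') \<sigma>'' \<longleftrightarrow> (\<exists>\<sigma>'. path R \<sigma> \<tau> \<sigma>' \<and> path R \<sigma>' \<tau>' \<sigma>'')"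
proof (induction \<tau>' arbitrary: \<sigma>'' rule: rev_induct)
  case (snoc \<phi> \<tau>')
  have "path R \<sigma> (\<tau> @ \<tau>' @ [\<phi>]) \<sigma>'' \<longleftrightarrow> (\<exists>\<sigma>'. path R \<sigma> (\<tau> @ \<tau>') \<sigma>' \<and> R \<phi> \<sigma>' \<sigma>'')"
    using path_snoc_iff[of R \<sigma> "\<tau> @ \<tau>'" \<phi> \<sigma>''] by simp
  then show ?case unfolding snoc.IH path_snoc_iff by blast
qed simp

lemma step_SpecClient_Call:
  assumes "wf_spec \<Gamma>" "step f (SpecClient \<Gamma> Cs) (t, Call m None) \<sigma> = Outcomes B" "(\<sigma>', \<phi>') \<in> B"
  obtains "\<Gamma> m = None" "\<phi>' = (t, Call m None)" "\<sigma>' = \<sigma>"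
  | p q a where "\<Gamma> m = Some (p, q)" "\<phi>' = (t, Call m (Some a))" "a \<in> p t" "a \<star> \<sigma>' = Some \<sigma>"
proof (cases "\<Gamma> m")
  case None
  then show ?thesis using that(1) assms by auto
next
  case (Some pq)
  obtain p q where pq: "pq = (p, q)" by fastforce
  then have "precise (p t)" using assms(1) Some by (auto simp: wf_spec_def)
  then show ?thesis
    using that(2) assms(2,3) Some pq split_pred_SomeD[of "p t" \<sigma>]
    by (auto split: option.splits)
qed

lemma step_SpecLib_Ret:
  assumes "wf_spec \<Gamma>" "step f (SpecLib L \<Gamma>) (t, Ret m None) \<sigma> = Outcomes B" "(\<sigma>', \<phi>') \<in> B"
  obtains "\<Gamma> m = None" "\<phi>' = (t, Ret m None)" "\<sigma>' = \<sigma>"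
  | p q a where "\<Gamma> m = Some (p, q)" "\<phi>' = (t, Ret m (Some a))" "a \<in> q t" "a \<star> \<sigma>' = Some \<sigma>"
proof (cases "\<Gamma> m")
  case None
  then show ?thesis using that(1) assms by auto
next
  case (Some pq)
  obtain p q where pq: "pq = (p, q)" by fastforce
  then have "precise (q t)" using assms(1) Some by (auto simp: wf_spec_def)
  then show ?thesis
    using that(2) assms(2,3) Some pq split_pred_SomeD[of "q t" \<sigma>]
    by (auto split: option.splits)
qed

text \<open>Groundness matters for methods without a specification: \<open>step\<close> copies
  whatever annotation it meets, and only a missing one stands for the transfer of the unit.\<close>

lemma eval_run_SpecClient_path:
  assumes "wf_spec \<Gamma>"
  shows "eval_run f (SpecClient \<Gamma> Cs) \<sigma> \<tau> \<sigma>' \<tau>' \<Longrightarrow> ground \<tau> = \<tau> \<Longrightarrow> path (client_step f) \<sigma> \<tau>' \<sigma>'"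
proof (induction rule: eval_run.induct)
  case (eval_run_snoc \<tau> \<sigma>' \<tau>' \<phi> B \<sigma>'' \<phi>')
  have g: "ground_action \<phi> = \<phi>" using eval_run_snoc.prems by simp
  have "client_step f \<phi>' \<sigma>' \<sigma>''"
  proof (cases \<phi> rule: action_cases)
    case (Exec t c)
    with eval_run_snoc.hyps show ?thesis
      by (auto simp: client_step_def exec_step_def split: faulting.splits)
  next
    case (Call t m a)
    with g eval_run_snoc.hyps(2) have "step f (SpecClient \<Gamma> Cs) (t, Call m None) \<sigma>' = Outcomes B" by simp
    from step_SpecClient_Call[OF assms this eval_run_snoc.hyps(3)] show ?thesis
      by cases (auto simp: client_step_def sep_unit sep_unit_right sep_commute)
  next
    case (Ret t m a)
    with g eval_run_snoc.hyps show ?thesis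
      by (auto simp: client_step_def sep_unit_right split: option.splits)
  qed
  then show ?case using eval_run_snoc.IH eval_run_snoc.prems by (auto simp: path_snoc_iff)
qed simp

lemma eval_run_SpecLib_path:
  assumes "wf_spec \<Gamma>"
  shows "eval_run f (SpecLib L \<Gamma>) \<sigma> \<tau> \<sigma>' \<tau>' \<Longrightarrow> ground \<tau> = \<tau> \<Longrightarrow> path (lib_step f) \<sigma> \<tau>' \<sigma>'"
proof (induction rule: eval_run.induct)
  case (eval_run_snoc \<tau> \<sigma>' \<tau>' \<phi> B \<sigma>'' \<phi>')
  have g: "ground_action \<phi> = \<phi>" using eval_run_snoc.prems by simp
  have "lib_step f \<phi>' \<sigma>' \<sigma>''"
  proof (cases \<phi> rule: action_cases)
    case (Exec t c)
    with eval_run_snoc.hyps show ?thesis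
      by (auto simp: lib_step_def exec_step_def split: faulting.splits)
  next
    case (Ret t m a)
    with g eval_run_snoc.hyps(2) have "step f (SpecLib L \<Gamma>) (t, Ret m None) \<sigma>' = Outcomes B" by simp
    from step_SpecLib_Ret[OF assms this eval_run_snoc.hyps(3)] show ?thesis
      by cases (auto simp: lib_step_def sep_unit sep_unit_right sep_commute)
  next
    case (Call t m a)
    with g eval_run_snoc.hyps show ?thesis
      by (auto simp: lib_step_def sep_unit_right split: option.splits)
  qed
  then show ?case using eval_run_snoc.IH eval_run_snoc.prems by (auto simp: path_snoc_iff)
qed simp

lemma path_eval_run_Complete:
  "path (global_step f) \<sigma> \<tau> \<sigma>' \<Longrightarrow> eval_run f (Complete Cs L) \<sigma> (ground \<tau>) \<sigma>' (ground \<tau>)"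
proof (induction rule: path.induct)
  case path_Nil
  then show ?case by (simp add: eval_run.intros)
next
  case (path_snoc \<tau> \<sigma>' \<phi> \<sigma>'')
  have "\<exists>B. step f (Complete Cs L) (ground_action \<phi>) \<sigma>' = Outcomes B \<and> (\<sigma>'', ground_action \<phi>) \<in> B"
    using path_snoc.hyps(2) by (cases \<phi> rule: action_cases) (auto simp: global_step_def exec_step_def)
  then show ?case using eval_run_snoc[OF path_snoc.IH] unfolding map_append list.map by blast
qed

section \<open>Decomposition of complete programs\<close>

lemma strongly_localD:
  "strongly_local f \<Longrightarrow> \<sigma>1 \<star> \<sigma>2 = Some \<sigma> \<Longrightarrow> f t c \<sigma>1 = Outcomes A \<Longrightarrow> f t c \<sigma> = Outcomes (A \<star>\<^sub>s {\<sigma>2})"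
  unfolding strongly_local_def by blast

lemma history_snoc: "history (\<tau> @ [\<phi>]) = history \<tau> @ (if is_exec \<phi> then [] else [\<phi>])"
  by (auto simp: history_def not_is_exec)

lemma step_Exec_OutcomesE:
  assumes "step f P (t, Exec c) \<sigma> = Outcomes B"
  obtains A where "f t c \<sigma> = Outcomes A" "B = {(\<sigma>', (t, Exec c)) | \<sigma>'. \<sigma>' \<in> A}"
  using assms by (auto split: faulting.splits)

locale safe_components =
  fixes f :: "('c, 's::separation_algebra) transformer"
    and \<Gamma> :: "('m, 's) spec" and Cs :: "('c, 'm) client" and L :: "('c, 'm) library"
    and I J :: "'s set"
  assumes local: "strongly_local f"
    and spec: "wf_spec \<Gamma>"
    and client_safe: "safe f (SpecClient \<Gamma> Cs) I"
    and lib_safe: "safe f (SpecLib L \<Gamma>) J"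
begin

text \<open>The owner of a command is fixed by whether its thread is inside a call. Safety of the
  owner excludes a fault at its part of the state, and strong locality then says that each outcome
  at the sum is an outcome at that part with the other part untouched. For an interface action the
  component giving up state determines the annotation and the other one can choose the same, so the
  two histories agree.\<close>

lemma decomposition:
  assumes "\<sigma>c \<in> I" "\<sigma>l \<in> J" "\<sigma>c \<star> \<sigma>l = Some \<sigma>0"
    and "eval_run f (Complete Cs L) \<sigma>0 \<tau> \<sigma> \<tau>'" "\<tau> \<in> traces (Complete Cs L)"
  shows "\<exists>\<sigma>c' \<sigma>l' \<tau>c \<tau>l. eval_run f (SpecClient \<Gamma> Cs) \<sigma>c (client \<tau>) \<sigma>c' \<tau>c \<and>
    eval_run f (SpecLib L \<Gamma>) \<sigma>l (lib \<tau>) \<sigma>l' \<tau>l \<and> \<sigma>c' \<star> \<sigma>l' = Some \<sigma> \<and> history \<tau>c = history \<tau>l"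
  using assms(4,5)
proof (induction rule: eval_run.induct)
  case eval_run_Nil
  show ?case
    using assms(3) eval_run.eval_run_Nil[of f "SpecClient \<Gamma> Cs" \<sigma>c] eval_run.eval_run_Nil[of f "SpecLib L \<Gamma>" \<sigma>l]
    by fastforce
next
  case (eval_run_snoc \<tau> \<sigma> \<tau>' \<phi> B \<sigma>' \<phi>')
  obtain \<sigma>c' \<sigma>l' \<tau>c \<tau>l where cl: "eval_run f (SpecClient \<Gamma> Cs) \<sigma>c (client \<tau>) \<sigma>c' \<tau>c"
    and li: "eval_run f (SpecLib L \<Gamma>) \<sigma>l (lib \<tau>) \<sigma>l' \<tau>l"
    and sum: "\<sigma>c' \<star> \<sigma>l' = Some \<sigma>" and his: "history \<tau>c = history \<tau>l"
    using eval_run_snoc.IH traces_prefix[OF eval_run_snoc.prems] by blast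
  note tr = client_traces_decomposition[OF eval_run_snoc.prems, of \<Gamma>]
  have sum': "\<sigma>l' \<star> \<sigma>c' = Some \<sigma>" using sum by (simp add: sep_commute)
  have g: "ground_action \<phi> = \<phi>" using traces_ground[OF eval_run_snoc.prems] by simp
  show ?case
  proof (cases \<phi> rule: action_cases)
    case (Exec t c)
    then obtain A0 where A0: "f t c \<sigma> = Outcomes A0" "\<sigma>' \<in> A0"
      using eval_run_snoc.hyps by (cases "f t c \<sigma>") auto
    show ?thesis
    proof (cases "in_call t \<tau>")
      case True
      then have pr: "client (\<tau> @ [\<phi>]) = client \<tau>" "lib (\<tau> @ [\<phi>]) = lib \<tau> @ [\<phi>]"
        using Exec by (simp_all add: client_snoc lib_snoc)
      obtain B' where B': "step f (SpecLib L \<Gamma>) (t, Exec c) \<sigma>l' = Outcomes B'"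
        using safe_stepE[OF lib_safe assms(2) _ li] tr(2) pr(2) Exec by metis
      then obtain A where A: "f t c \<sigma>l' = Outcomes A" "B' = {(\<sigma>', (t, Exec c)) | \<sigma>'. \<sigma>' \<in> A}"
        by (rule step_Exec_OutcomesE)
      with A0 strongly_localD[OF local sum' A(1)] obtain x where x: "x \<in> A" "x \<star> \<sigma>c' = Some \<sigma>'"
        by (auto simp: sep_set_def)
      then have "eval_run f (SpecLib L \<Gamma>) \<sigma>l (lib \<tau> @ [\<phi>]) x (\<tau>l @ [\<phi>])"
        using eval_run.eval_run_snoc[OF li B', of x \<phi>] A(2) Exec by simp
      then show ?thesis
        using cl pr x(2) his Exec sep_commute[of x \<sigma>c'] by (fastforce simp: history_snoc)
    next
      case False
      then have pr: "client (\<tau> @ [\<phi>]) = client \<tau> @ [\<phi>]" "lib (\<tau> @ [\<phi>]) = lib \<tau>"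
        using Exec by (simp_all add: client_snoc lib_snoc)
      obtain B' where B': "step f (SpecClient \<Gamma> Cs) (t, Exec c) \<sigma>c' = Outcomes B'"
        using safe_stepE[OF client_safe assms(1) _ cl] tr(1) pr(1) Exec by metis
      then obtain A where A: "f t c \<sigma>c' = Outcomes A" "B' = {(\<sigma>', (t, Exec c)) | \<sigma>'. \<sigma>' \<in> A}"
        by (rule step_Exec_OutcomesE)
      with A0 strongly_localD[OF local sum A(1)] obtain x where x: "x \<in> A" "x \<star> \<sigma>l' = Some \<sigma>'"
        by (auto simp: sep_set_def)
      then have "eval_run f (SpecClient \<Gamma> Cs) \<sigma>c (client \<tau> @ [\<phi>]) x (\<tau>c @ [\<phi>])"
        using eval_run.eval_run_snoc[OF cl B', of x \<phi>] A(2) Exec by simp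
      then show ?thesis
        using li pr x(2) his Exec by (fastforce simp: history_snoc)
    qed
  next
    case (Call t m a)
    then have \<phi>: "\<phi> = (t, Call m None)" using g by simp
    then have [simp]: "\<sigma>' = \<sigma>" using eval_run_snoc.hyps by auto
    have pr: "client (\<tau> @ [\<phi>]) = client \<tau> @ [\<phi>]" "lib (\<tau> @ [\<phi>]) = lib \<tau> @ [\<phi>]"
      using \<phi> by (simp_all add: client_snoc lib_snoc)
    obtain B1 where B1: "step f (SpecClient \<Gamma> Cs) (t, Call m None) \<sigma>c' = Outcomes B1"
      using safe_stepE[OF client_safe assms(1) _ cl] tr(1) pr(1) \<phi> by metis
    obtain B2 where B2: "step f (SpecLib L \<Gamma>) (t, Call m None) \<sigma>l' = Outcomes B2"
      using safe_stepE[OF lib_safe assms(2) _ li] tr(2) pr(2) \<phi> by metis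
    obtain \<psi> x y where xy: "(x, \<psi>) \<in> B1" "(y, \<psi>) \<in> B2" "x \<star> y = Some \<sigma>"
    proof (cases "\<Gamma> m")
      case None
      then show ?thesis using B1 B2 sum that by auto
    next
      case (Some pq)
      obtain p q where pq: "pq = (p, q)" by fastforce
      then obtain x \<psi> where x: "(x, \<psi>) \<in> B1" using B1 Some by (auto split: option.splits)
      from step_SpecClient_Call[OF spec B1 this] Some pq obtain s where
        s: "\<psi> = (t, Call m (Some s))" "s \<in> p t" "s \<star> x = Some \<sigma>c'" by (metis Pair_inject option.distinct(1) option.inject)
      \<comment> \<open>The library accepts every compatible state in \<open>p t\<close>. The one
        given up by the client is compatible, being a part of the client state in the old
        sum.\<close>
      then obtain y where "s \<star> \<sigma>l' = Some y" "x \<star> y = Some \<sigma>"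
        using sep_assocD[of x s \<sigma>c' \<sigma>l' \<sigma>] sum sep_commute[of x s] by auto
      then have "(y, \<psi>) \<in> B2" using B2 Some pq s sep_commute[of s \<sigma>l'] by auto
      then show ?thesis using that x \<open>x \<star> y = Some \<sigma>\<close> by blast
    qed
    have "is_exec \<psi> \<longleftrightarrow> False" using step_ground[OF B1 xy(1)] ground_action_simps(2)[of \<psi>] by simp
    then show ?thesis
      using eval_run.eval_run_snoc[OF cl B1 xy(1)] eval_run.eval_run_snoc[OF li B2 xy(2)] xy(3) pr his \<phi>
      by (fastforce simp: history_snoc)
  next
    case (Ret t m a)
    then have \<phi>: "\<phi> = (t, Ret m None)" using g by simp
    then have [simp]: "\<sigma>' = \<sigma>" using eval_run_snoc.hyps by auto
    have pr: "client (\<tau> @ [\<phi>]) = client \<tau> @ [\<phi>]" "lib (\<tau> @ [\<phi>]) = lib \<tau> @ [\<phi>]"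
      using \<phi> by (simp_all add: client_snoc lib_snoc)
    obtain B1 where B1: "step f (SpecClient \<Gamma> Cs) (t, Ret m None) \<sigma>c' = Outcomes B1"
      using safe_stepE[OF client_safe assms(1) _ cl] tr(1) pr(1) \<phi> by metis
    obtain B2 where B2: "step f (SpecLib L \<Gamma>) (t, Ret m None) \<sigma>l' = Outcomes B2"
      using safe_stepE[OF lib_safe assms(2) _ li] tr(2) pr(2) \<phi> by metis
    obtain \<psi> x y where xy: "(x, \<psi>) \<in> B1" "(y, \<psi>) \<in> B2" "x \<star> y = Some \<sigma>"
    proof (cases "\<Gamma> m")
      case None
      then show ?thesis using B1 B2 sum that by auto
    next
      case (Some pq)
      obtain p q where pq: "pq = (p, q)" by fastforce
      then obtain y \<psi> where y: "(y, \<psi>) \<in> B2" using B2 Some by (auto split: option.splits)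
      from step_SpecLib_Ret[OF spec B2 this] Some pq obtain s where
        s: "\<psi> = (t, Ret m (Some s))" "s \<in> q t" "s \<star> y = Some \<sigma>l'" by (metis Pair_inject option.distinct(1) option.inject)
      then obtain x where "s \<star> \<sigma>c' = Some x" "y \<star> x = Some \<sigma>"
        using sep_assocD[of y s \<sigma>l' \<sigma>c' \<sigma>] sum' sep_commute[of y s] by auto
      moreover from this have "(x, \<psi>) \<in> B1" using B1 Some pq s sep_commute[of s \<sigma>c'] by auto
      ultimately show ?thesis using that y sep_commute[of x y] by auto
    qed
    have "is_exec \<psi> \<longleftrightarrow> False" using step_ground[OF B1 xy(1)] ground_action_simps(2)[of \<psi>] by simp
    then show ?thesis
      using eval_run.eval_run_snoc[OF cl B1 xy(1)] eval_run.eval_run_snoc[OF li B2 xy(2)] xy(3) pr his \<phi>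
      by (fastforce simp: history_snoc)
  qed
qed

text \<open>By the contrapositive of strong locality, a fault at the sum is a fault at both parts.
  The faulting command is kept by one of the two projections, whose program would then be
  unsafe.\<close>

lemma complete_safe: "safe f (Complete Cs L) (I \<star>\<^sub>s J)"
  unfolding safe_iff
proof (intro ballI allI impI notI)
  fix \<sigma>0 \<tau> \<phi> \<sigma> \<tau>'
  assume "\<sigma>0 \<in> I \<star>\<^sub>s J" and tr: "\<tau> @ [\<phi>] \<in> traces (Complete Cs L)"
    and run: "eval_run f (Complete Cs L) \<sigma>0 \<tau> \<sigma> \<tau>'" and fault: "step f (Complete Cs L) \<phi> \<sigma> = Fault"
  then obtain \<sigma>c \<sigma>l where 0: "\<sigma>c \<in> I" "\<sigma>l \<in> J" "\<sigma>c \<star> \<sigma>l = Some \<sigma>0"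
    by (auto simp: sep_set_def)
  obtain \<sigma>c' \<sigma>l' \<tau>c \<tau>l where cl: "eval_run f (SpecClient \<Gamma> Cs) \<sigma>c (client \<tau>) \<sigma>c' \<tau>c"
    and li: "eval_run f (SpecLib L \<Gamma>) \<sigma>l (lib \<tau>) \<sigma>l' \<tau>l"
    and sum: "\<sigma>c' \<star> \<sigma>l' = Some \<sigma>"
    using decomposition[OF 0 run traces_prefix[OF tr]] by blast
  have sum': "\<sigma>l' \<star> \<sigma>c' = Some \<sigma>" using sum by (simp add: sep_commute)
  obtain t c where \<phi>: "\<phi> = (t, Exec c)" and "f t c \<sigma> = Fault"
    using fault by (cases \<phi> rule: action_cases) (auto split: faulting.splits)
  then have "f t c \<sigma>c' = Fault" "f t c \<sigma>l' = Fault"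
    using strongly_localD[OF local sum] strongly_localD[OF local sum']
    by (metis faulting.distinct(1) faulting.exhaust)+
  then have "step f (SpecClient \<Gamma> Cs) \<phi> \<sigma>c' = Fault" "step f (SpecLib L \<Gamma>) \<phi> \<sigma>l' = Fault"
    using \<phi> by simp_all
  moreover have "client (\<tau> @ [\<phi>]) = client \<tau> @ [\<phi>] \<or> lib (\<tau> @ [\<phi>]) = lib \<tau> @ [\<phi>]"
    using \<phi> by (simp add: client_snoc lib_snoc)
  ultimately show False
    using client_traces_decomposition[OF tr, of \<Gamma>] cl li 0 client_safe lib_safe
    unfolding safe_iff by metis
qed

end

section \<open>The linearizability relation, thread by thread\<close>

lemma thread_proj_take_less:
  assumes "i < j" "j \<le> length H" "fst (H ! i) = t"
  shows "length (thread_proj t (take i H)) < length (thread_proj t (take j H))"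
proof -
  define R where "R = drop (Suc i) (take j H)"
  have "take i (take j H) = take i H" "take j H ! i = H ! i" using assms by simp_all
  then have "take j H = take i H @ H ! i # R"
    using assms id_take_nth_drop[of i "take j H"] unfolding R_def by (metis length_take min.absorb2)
  then show ?thesis using assms(3) by simp
qed

text \<open>An action keeps its rank within its thread. Since \<rho> is monotone on the thread and
  onto, it maps the positions of the thread before \<open>i\<close> bijectively to those before
  \<open>\<rho> i\<close>; counting them gives the claim.\<close>

lemma hist_le_thread_index:
  fixes H H' :: "('c, 'm, 's) trace"
  assumes bij: "bij_betw \<rho> {..<length H} {..<length H'}"
    and eq: "\<forall>i<length H. H ! i = H' ! \<rho> i"
    and mono: "\<And>i j. i < j \<Longrightarrow> j < length H \<Longrightarrow> fst (H ! i) = fst (H ! j) \<Longrightarrow> \<rho> i < \<rho> j"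
    and i: "i < length H" "fst (H ! i) = t"
  shows "length (thread_proj t (take (\<rho> i) H')) = length (thread_proj t (take i H))"
proof -
  have \<rho>_less: "\<rho> j < length H'" if "j < length H" for j using bij_betwE[OF bij] that by auto
  have len: "length (thread_proj t (take k H)) = card {j. j < k \<and> fst (H ! j) = t}" if "k \<le> length H"
    for k and H :: "('c, 'm, 's) trace"
  proof -
    have "{j. j < length (take k H) \<and> fst (take k H ! j) = t} = {j. j < k \<and> fst (H ! j) = t}"
      using that by auto
    then show ?thesis unfolding length_filter_conv_card by simp
  qed
  have "\<rho> ` {j. j < i \<and> fst (H ! j) = t} = {j. j < \<rho> i \<and> fst (H' ! j) = t}"
  proof (intro set_eqI iffI)
    fix k assume "k \<in> \<rho> ` {j. j < i \<and> fst (H ! j) = t}"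
    then obtain j where j: "j < i" "fst (H ! j) = t" "k = \<rho> j" by blast
    have "\<rho> j < \<rho> i" using mono[OF j(1) i(1)] j(2) i(2) by simp
    moreover have "H ! j = H' ! \<rho> j" using eq j(1) i(1) by simp
    ultimately show "k \<in> {j. j < \<rho> i \<and> fst (H' ! j) = t}" using j by simp
  next
    fix k assume k: "k \<in> {j. j < \<rho> i \<and> fst (H' ! j) = t}"
    then have "k \<in> \<rho> ` {..<length H}" using \<rho>_less[OF i(1)] bij_betw_imp_surj_on[OF bij] by auto
    then obtain j where j: "j < length H" "k = \<rho> j" by auto
    have "H ! j = H' ! \<rho> j" using eq j(1) by blast
    then have jt: "fst (H ! j) = t" using k j(2) by simp
    have "\<not> i < j" using mono[of i j] j k i jt by auto
    moreover have "i \<noteq> j" using j k by auto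
    ultimately have "j < i" by simp
    then show "k \<in> \<rho> ` {j. j < i \<and> fst (H ! j) = t}" using j jt by blast
  qed
  note img = this
  have inj: "inj_on \<rho> {j. j < i \<and> fst (H ! j) = t}"
    by (rule inj_on_subset[OF bij_betw_imp_inj_on[OF bij]]) (use i(1) in auto)
  have "card {j. j < \<rho> i \<and> fst (H' ! j) = t} = card {j. j < i \<and> fst (H ! j) = t}"
    using card_image[OF inj] unfolding img .
  then show ?thesis using len[of i H] len[of "\<rho> i" H'] i(1) \<rho>_less[OF i(1)] by simp
qed

lemma nth_thread_proj:
  assumes "i < length H" "fst (H ! i) = t"
  shows "length (thread_proj t (take i H)) < length (thread_proj t H)"
    and "thread_proj t H ! length (thread_proj t (take i H)) = H ! i"
proof -
  have "thread_proj t H = thread_proj t (take i H @ H ! i # drop (Suc i) H)"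
    by (subst id_take_nth_drop[OF assms(1)]) (rule refl)
  also have "\<dots> = thread_proj t (take i H) @ H ! i # thread_proj t (drop (Suc i) H)"
    using assms(2) by simp
  finally have *: "thread_proj t H = thread_proj t (take i H) @ H ! i # thread_proj t (drop (Suc i) H)" .
  show "length (thread_proj t (take i H)) < length (thread_proj t H)" by (subst *) simp
  show "thread_proj t H ! length (thread_proj t (take i H)) = H ! i" by (subst *) simp
qed

lemma thread_proj_index:
  "n < length (thread_proj t H) \<Longrightarrow>
    \<exists>i<length H. fst (H ! i) = t \<and> length (thread_proj t (take i H)) = n"
proof (induction H rule: rev_induct)
  case (snoc \<phi> H)
  show ?case
  proof (cases "n < length (thread_proj t H)")
    case True
    with snoc.IH obtain i where "i < length H" "fst (H ! i) = t" "length (thread_proj t (take i H)) = n"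
      by blast
    then show ?thesis by (intro exI[of _ i]) (simp add: nth_append)
  next
    case False
    then have "fst \<phi> = t" "n = length (thread_proj t H)" using snoc.prems by (auto split: if_splits)
    then show ?thesis by (intro exI[of _ "length H"]) simp
  qed
qed simp

text \<open>Equal ranks and equal actions make the two projections agree entry by entry.\<close>

lemma hist_le_thread_proj:
  assumes "hist_le H H'"
  shows "thread_proj t H = thread_proj t H'"
proof -
  obtain \<rho> where bij: "bij_betw \<rho> {..<length H} {..<length H'}"
    and eq: "\<forall>i<length H. H ! i = H' ! \<rho> i"
    and mono: "\<And>i j. i < j \<Longrightarrow> j < length H \<Longrightarrow> fst (H ! i) = fst (H ! j) \<Longrightarrow> \<rho> i < \<rho> j"
    using assms unfolding hist_le_def by blast
  have \<rho>_less: "\<rho> j < length H'" if "j < length H" for j using bij_betwE[OF bij] that by auto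
  have idx: "length (thread_proj t (take (\<rho> i) H')) = length (thread_proj t (take i H))"
    if "i < length H" "fst (H ! i) = t" for i
    by (rule hist_le_thread_index[OF bij eq _ that]) (rule mono)
  have at: "n < length (thread_proj t H') \<and> thread_proj t H' ! n = thread_proj t H ! n"
    if n: "n < length (thread_proj t H)" for n
  proof -
    obtain i where i: "i < length H" "fst (H ! i) = t" "length (thread_proj t (take i H)) = n"
      using thread_proj_index[OF n] by blast
    have "fst (H' ! \<rho> i) = t" using eq i by simp
    from nth_thread_proj[OF \<rho>_less[OF i(1)] this] nth_thread_proj[OF i(1,2)] show ?thesis
      using idx[OF i(1,2)] i eq by simp
  qed
  have conv: "n < length (thread_proj t H)" if n: "n < length (thread_proj t H')" for n
  proof -
    obtain k where k: "k < length H'" "fst (H' ! k) = t" "length (thread_proj t (take k H')) = n"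
      using thread_proj_index[OF n] by blast
    then obtain i where i: "i < length H" "k = \<rho> i" using bij by (auto simp: bij_betw_def)
    then have "fst (H ! i) = t" using eq k by auto
    from nth_thread_proj(1)[OF i(1) this] idx[OF i(1) this] show ?thesis using k i by simp
  qed
  have "length (thread_proj t H') = length (thread_proj t H)"
    using conv[of "length (thread_proj t H)"] at[of "length (thread_proj t H')"]
    by (meson linorder_neqE_nat less_irrefl)
  then show ?thesis using at by (intro nth_equalityI) auto
qed

text \<open>Occurrences of actions are identified by their position in the projection to their thread.\<close>

lemma hist_le_ret_before_call:
  assumes "hist_le H H'"
    and H: "H = P @ a # Q" and H': "H' = P' @ a' # Q'"
    and a: "is_call a" "fst a = t" "fst a' = t"
    and same: "length (thread_proj t P) = length (thread_proj t P')"
    and P: "P = P1 @ y # P2" "is_ret y"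
  shows "length (thread_proj (fst y) P1) < length (thread_proj (fst y) P')"
proof -
  obtain \<rho> where bij: "bij_betw \<rho> {..<length H} {..<length H'}"
    and eq: "\<forall>i<length H. H ! i = H' ! \<rho> i"
    and mono: "\<And>i j. i < j \<Longrightarrow> j < length H \<Longrightarrow>
      fst (H ! i) = fst (H ! j) \<or> is_ret (H ! i) \<and> is_call (H ! j) \<Longrightarrow> \<rho> i < \<rho> j"
    using assms(1) unfolding hist_le_def by blast
  have \<rho>_less: "\<rho> j < length H'" if "j < length H" for j using bij_betwE[OF bij] that by auto
  have idx: "length (thread_proj (fst (H ! i)) (take (\<rho> i) H')) = length (thread_proj (fst (H ! i)) (take i H))"
    if "i < length H" for i
    by (rule hist_le_thread_index[OF bij eq _ that refl]) (rule mono; simp)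
  let ?i = "length P" and ?j = "length P1"
  have i: "?i < length H" "H ! ?i = a" "take ?i H = P" using H by simp_all
  have j: "?j < length H" "H ! ?j = y" "take ?j H = P1" using H P by simp_all
  have i': "length P' < length H'" "fst (H' ! length P') = t" "take (length P') H' = P'" using H' a by simp_all
  have "fst (H' ! \<rho> ?i) = t" using eq i a by metis
  have "length (thread_proj t (take (\<rho> ?i) H')) = length (thread_proj t (take (length P') H'))"
    using idx[OF i(1)] same i i' a by simp
  \<comment> \<open>A position in a history is determined by its thread and its rank in that thread;
    hence the position of \<open>a\<close> is sent to that of \<open>a'\<close>.\<close>
  then have "\<rho> ?i = length P'"
    using thread_proj_take_less[of "\<rho> ?i" "length P'" H' t] thread_proj_take_less[of "length P'" "\<rho> ?i" H' t]
      i' \<rho>_less[OF i(1)] \<open>fst (H' ! \<rho> ?i) = t\<close> by (cases "\<rho> ?i" "length P'" rule: linorder_cases) auto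
  moreover have "\<rho> ?j < \<rho> ?i" using mono[of ?j ?i] i j P a by simp
  moreover have "fst (H' ! \<rho> ?j) = fst y" using eq j by metis
  ultimately show ?thesis
    using thread_proj_take_less[of "\<rho> ?j" "length P'" H' "fst y"] idx[OF j(1)] i' j by simp
qed

section \<open>Simulation\<close>

text \<open>Strong locality describes the outcomes at the larger state but does not ensure that the
  chosen outcome \<open>x'\<close> is compatible with the rest. Footprint preservation does:
  \<open>x'\<close> has the same partners as \<open>x\<close>.\<close>

lemma exec_step_frame:
  assumes "footprint_preserving f" "strongly_local f"
    and "exec_step f \<phi> x x'" "msum (add_mset x M) = Some g"
  shows "\<exists>g'. exec_step f \<phi> g g' \<and> msum (add_mset x' M) = Some g'"
proof -
  obtain t c A where \<phi>: "\<phi> = (t, Exec c)" "f t c x = Outcomes A" "x' \<in> A"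
    using assms(3) by (auto simp: exec_step_def)
  obtain r where r: "msum M = Some r" "x \<star> r = Some g"
    using assms(4) by (cases "msum M") (auto simp: msum_add)
  have "\<delta> x' = \<delta> x" using assms(1) \<phi>(2,3) unfolding footprint_preserving_def by blast
  then obtain g' where g': "x' \<star> r = Some g'" using fp_eq_defined[of x' x r] r(2) by auto
  then have "g' \<in> A \<star>\<^sub>s {r}" using \<phi>(3) by (auto simp: sep_set_def)
  moreover have "f t c g = Outcomes (A \<star>\<^sub>s {r})"
    by (rule strongly_localD[OF assms(2) r(2) \<phi>(2)])
  ultimately show ?thesis
    using \<phi>(1) r(1) g' by (auto simp: exec_step_def msum_add)
qed

text \<open>
  \<open>lag t \<tau>p \<pi>\<close>: with respect to thread \<open>t\<close>, the constructed trace \<open>\<pi>\<close> contains the same library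
  actions as the processed part \<open>\<tau>p\<close> of the library trace, up to one delayed return or one early call.
\<close>

definition lag :: "tid \<Rightarrow> ('c, 'm, 's) trace \<Rightarrow> ('c, 'm, 's) trace \<Rightarrow> bool" where
  "lag t \<tau>p \<pi> \<longleftrightarrow> thread_proj t (lib \<pi>) = thread_proj t \<tau>p \<or>
     (\<exists>y. is_ret y \<and> thread_proj t \<tau>p = thread_proj t (lib \<pi>) @ [y]) \<or>
     (\<exists>a. is_call a \<and> thread_proj t (lib \<pi>) = thread_proj t \<tau>p @ [a])"

lemma thread_history_of_proj: "thread_history t \<tau> = filter (\<lambda>\<phi>. \<not> is_exec \<phi>) (thread_proj t \<tau>)"
  by (auto simp: thread_history_def conj_commute intro: filter_cong)

lemma lag_cases [consumes 1, case_names level delayed early]: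
  assumes "lag t \<tau>p \<pi>"
  obtains "thread_proj t (lib \<pi>) = thread_proj t \<tau>p" "thread_history t \<pi> = thread_history t \<tau>p"
  | y where "is_ret y" "thread_proj t \<tau>p = thread_proj t (lib \<pi>) @ [y]"
      "thread_history t \<tau>p = thread_history t \<pi> @ [y]"
  | a where "is_call a" "thread_proj t (lib \<pi>) = thread_proj t \<tau>p @ [a]"
      "thread_history t \<pi> = thread_history t \<tau>p @ [a]"
proof -
  have h: "thread_history t \<pi> = filter (\<lambda>\<phi>. \<not> is_exec \<phi>) (thread_proj t (lib \<pi>))"
    using thread_history_of_proj[of t "lib \<pi>"] by simp
  have h': "thread_history t \<tau>p = filter (\<lambda>\<phi>. \<not> is_exec \<phi>) (thread_proj t \<tau>p)"
    by (rule thread_history_of_proj)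
  from assms consider "thread_proj t (lib \<pi>) = thread_proj t \<tau>p"
    | y where "is_ret y" "thread_proj t \<tau>p = thread_proj t (lib \<pi>) @ [y]"
    | a where "is_call a" "thread_proj t (lib \<pi>) = thread_proj t \<tau>p @ [a]"
    unfolding lag_def by blast
  then show thesis
  proof cases
    case 1
    then show thesis using that(1) h h' by simp
  next
    case (2 y)
    then show thesis using that(2)[of y] h h' not_is_exec[of y] by simp
  next
    case (3 a)
    then show thesis using that(3)[of a] h h' not_is_exec[of a] by simp
  qed
qed

text \<open>\<open>\<tau>p\<close> and \<open>\<tau>e\<close> are the processed parts of the library
  and the client run, with \<open>\<sigma>l\<close> and \<open>\<sigma>c\<close> as the states
  reached. \<open>B\<close> collects the returns already processed by the library but not yet in
  \<open>\<pi>\<close>, and \<open>E\<close> the calls already in \<open>\<pi>\<close> but not yet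
  processed by the library. Equations between multisets make both exact differences, without
  truncated subtraction.\<close>

definition sim ::
    "('c, 's::separation_algebra) transformer \<Rightarrow> 's \<Rightarrow> 's \<Rightarrow> 's \<Rightarrow>
     ('c, 'm, 's) trace \<Rightarrow> ('c, 'm, 's) trace \<Rightarrow> ('c, 'm, 's) trace \<Rightarrow> bool" where
  "sim f g0 \<sigma>c \<sigma>l \<tau>p \<tau>e \<pi> \<longleftrightarrow> (\<exists>g B E.
     path (global_step f) g0 \<pi> g \<and> client \<pi> = \<tau>e \<and> (\<forall>t. lag t \<tau>p \<pi>) \<and>
     mset (filter is_ret \<tau>p) = mset (filter is_ret \<pi>) + B \<and>
     mset (filter is_call \<pi>) = mset (filter is_call \<tau>p) + E \<and>
     msum (add_mset \<sigma>c (add_mset \<sigma>l (image_mset transferred (B + E)))) = Some g)"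

lemma sim_thread_history: "sim f g0 \<sigma>c \<sigma>l \<tau>p \<tau>e \<pi> \<Longrightarrow> thread_history t \<pi> = thread_history t \<tau>e"
  unfolding sim_def by (metis thread_history_client)

text \<open>Links the thread-wise lag to the global multisets: an interface action missing from one
  thread history is thereby found in \<open>B\<close> or \<open>E\<close>.\<close>

lemma count_thread_history:
  "fst \<phi> = t \<Longrightarrow> \<not> is_exec \<phi> \<Longrightarrow> count (mset (thread_history t \<tau>)) \<phi> = count (mset \<tau>) \<phi>"
  by (simp add: thread_history_def)

text \<open>A command runs framed in the global state, a call joins \<open>E\<close>, and a return
  leaves \<open>B\<close> and hands its state to the client. \<open>ready\<close> says that the
  library has already processed the return; \<open>order\<close> rules out a call placed while a
  return of the same thread is still delayed.\<close>

lemma sim_client_step: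
  assumes f: "footprint_preserving f" "strongly_local f"
    and sim: "sim f g0 \<sigma>c \<sigma>l \<tau>p \<tau>e \<pi>" and step: "client_step f \<phi> \<sigma>c \<sigma>c'"
    and wf: "is_ret \<phi> \<longleftrightarrow> in_call (fst \<phi>) \<tau>e"
    and ready: "is_ret \<phi> \<Longrightarrow>
      \<exists>r. thread_history (fst \<phi>) \<tau>p = thread_history (fst \<phi>) \<tau>e @ \<phi> # r"
    and order: "is_call \<phi> \<Longrightarrow>
      \<not> (\<exists>y. is_ret y \<and> thread_history (fst \<phi>) \<tau>p = thread_history (fst \<phi>) \<tau>e @ [y])"
  shows "sim f g0 \<sigma>c' \<sigma>l \<tau>p (\<tau>e @ [\<phi>]) (\<pi> @ [\<phi>])"
proof -
  let ?t = "fst \<phi>"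
  obtain g B E where pth: "path (global_step f) g0 \<pi> g" and cl: "client \<pi> = \<tau>e"
    and lag: "\<And>t. lag t \<tau>p \<pi>"
    and B: "mset (filter is_ret \<tau>p) = mset (filter is_ret \<pi>) + B"
    and E: "mset (filter is_call \<pi>) = mset (filter is_call \<tau>p) + E"
    and sum: "msum (add_mset \<sigma>c (add_mset \<sigma>l (image_mset transferred (B + E)))) = Some g"
    using sim unfolding sim_def by blast
  note h = sim_thread_history[OF sim]
  have ic: "in_call ?t \<pi> \<longleftrightarrow> in_call ?t \<tau>e" by (rule in_call_cong[OF h])
  have other: "lag t \<tau>p (\<pi> @ [\<phi>])" if "t \<noteq> ?t" for t
    using lag[of t] that by (auto simp: lag_def lib_snoc)
  have cl': "client (\<pi> @ [\<phi>]) = \<tau>e @ [\<phi>]"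
    using cl ic wf by (cases \<phi> rule: action_cases) (auto simp: client_snoc)
  show ?thesis
  proof (cases \<phi> rule: action_cases)
    case (Exec t c)
    then have "exec_step f \<phi> \<sigma>c \<sigma>c'" using step by (simp add: client_step_def)
    from exec_step_frame[OF f this sum] obtain g' where g': "exec_step f \<phi> g g'"
      "msum (add_mset \<sigma>c' (add_mset \<sigma>l (image_mset transferred (B + E)))) = Some g'" by blast
    have "path (global_step f) g0 (\<pi> @ [\<phi>]) g'"
      using pth g'(1) by (auto simp: path_snoc_iff global_step_def)
    moreover have "lag t' \<tau>p (\<pi> @ [\<phi>])" for t'
      using lag[of t'] Exec wf ic by (simp add: lag_def lib_snoc)
    ultimately show ?thesis
      unfolding sim_def using cl' B E g'(2) Exec
      by (intro exI[of _ g'] exI[of _ B] exI[of _ E]) simp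
  next
    case (Call t m a)
    have st: "\<sigma>c' \<star> transferred \<phi> = Some \<sigma>c" using step Call by (auto simp: client_step_def exec_step_def)
    have "\<not> in_call ?t \<tau>e" using wf Call by simp
    from lag[of ?t] have "thread_proj ?t (lib \<pi>) = thread_proj ?t \<tau>p"
    proof (cases rule: lag_cases)
      case (delayed y)
      have "is_call \<phi>" using Call by simp
      moreover have "thread_history ?t \<tau>p = thread_history ?t \<tau>e @ [y]"
        using delayed(3) h[of ?t] by simp
      ultimately show ?thesis using order delayed(1) by blast
    next
      case (early b)
      then have "in_call ?t \<tau>e" using h by (simp add: in_call_def)
      then show ?thesis using \<open>\<not> in_call ?t \<tau>e\<close> by simp
    qed
    then have "lag ?t \<tau>p (\<pi> @ [\<phi>])" using Call by (simp add: lag_def lib_snoc)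
    then have lags: "lag t' \<tau>p (\<pi> @ [\<phi>])" for t' using other by (cases "t' = ?t") simp_all
    have "path (global_step f) g0 (\<pi> @ [\<phi>]) g"
      using pth Call by (auto simp: path_snoc_iff global_step_def)
    moreover have "msum (add_mset \<sigma>c' (add_mset \<sigma>l (image_mset transferred (B + add_mset \<phi> E)))) = Some g"
    proof -
      have "add_mset \<sigma>c' (add_mset \<sigma>l (image_mset transferred (B + add_mset \<phi> E))) =
          add_mset \<sigma>c' (add_mset (transferred \<phi>) (add_mset \<sigma>l (image_mset transferred (B + E))))"
        by (simp add: add_mset_commute)
      then show ?thesis by (simp only: msum_split[OF st] sum)
    qed
    ultimately show ?thesis
      unfolding sim_def using cl' B E Call lags
      by (intro exI[of _ g] exI[of _ B] exI[of _ "add_mset \<phi> E"]) simp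
  next
    case (Ret t m a)
    have st: "\<sigma>c \<star> transferred \<phi> = Some \<sigma>c'" using step Ret by (auto simp: client_step_def exec_step_def)
    obtain r where r: "thread_history ?t \<tau>p = thread_history ?t \<tau>e @ \<phi> # r" using ready Ret by auto
    from lag[of ?t] have "thread_proj ?t \<tau>p = thread_proj ?t (lib \<pi>) @ [\<phi>]"
      by (cases rule: lag_cases) (use r h in auto)
    then have "lag ?t \<tau>p (\<pi> @ [\<phi>])" using Ret by (simp add: lag_def lib_snoc)
    then have lags: "lag t' \<tau>p (\<pi> @ [\<phi>])" for t' using other by (cases "t' = ?t") simp_all
    \<comment> \<open>The lag of the thread is exactly this return, so it occurs once more in
      \<open>\<tau>p\<close> than in \<open>\<pi>\<close> and must belong to
      \<open>B\<close>.\<close>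
    have "count (mset \<tau>p) \<phi> > count (mset \<pi>) \<phi>"
      using count_thread_history[of \<phi> ?t \<tau>p] count_thread_history[of \<phi> ?t \<pi>] r h Ret by simp
    moreover have "count (mset \<tau>p) \<phi> = count (mset \<pi>) \<phi> + count B \<phi>"
      using arg_cong[OF B, of "\<lambda>M. count M \<phi>"] Ret by simp
    ultimately have "count B \<phi> > 0" by simp
    then have "\<phi> \<in># B" by (rule count_greater_zero_iff[THEN iffD1])
    then obtain B' where B': "B = add_mset \<phi> B'" by (metis insert_DiffM)
    have "path (global_step f) g0 (\<pi> @ [\<phi>]) g"
      using pth Ret by (auto simp: path_snoc_iff global_step_def)
    moreover have "msum (add_mset \<sigma>c' (add_mset \<sigma>l (image_mset transferred (B' + E)))) = Some g"
    proof -
      have "add_mset \<sigma>c (add_mset \<sigma>l (image_mset transferred (B + E))) =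
          add_mset \<sigma>c (add_mset (transferred \<phi>) (add_mset \<sigma>l (image_mset transferred (B' + E))))"
        unfolding B' by (simp add: add_mset_commute)
      then show ?thesis using sum by (simp only: msum_split[OF st])
    qed
    ultimately show ?thesis
      unfolding sim_def using cl' B B' E Ret lags
      by (intro exI[of _ g] exI[of _ B'] exI[of _ E]) simp
  qed
qed

text \<open>Only a command extends \<open>\<pi>\<close>. A call is already there and merely passes
  its state from \<open>E\<close> to the library, and a return puts its state into \<open>B\<close>
  until the client reaches it.\<close>

lemma sim_lib_step:
  assumes f: "footprint_preserving f" "strongly_local f"
    and sim: "sim f g0 \<sigma>c \<sigma>l \<tau>p \<tau>e \<pi>" and step: "lib_step f \<phi> \<sigma>l \<sigma>l'"
    and wf: "is_call \<phi> \<longleftrightarrow> \<not> in_call (fst \<phi>) \<tau>p"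
    and ready: "is_call \<phi> \<Longrightarrow>
      \<exists>r. thread_history (fst \<phi>) \<tau>e = thread_history (fst \<phi>) \<tau>p @ \<phi> # r"
    and order: "\<not> is_call \<phi> \<Longrightarrow>
      \<not> (\<exists>a. is_call a \<and> thread_history (fst \<phi>) \<tau>e = thread_history (fst \<phi>) \<tau>p @ [a])"
  shows "\<exists>\<pi>'. sim f g0 \<sigma>c \<sigma>l' (\<tau>p @ [\<phi>]) \<tau>e \<pi>'"
proof -
  let ?t = "fst \<phi>"
  obtain g B E where pth: "path (global_step f) g0 \<pi> g" and cl: "client \<pi> = \<tau>e"
    and lag: "\<And>t. lag t \<tau>p \<pi>"
    and B: "mset (filter is_ret \<tau>p) = mset (filter is_ret \<pi>) + B"
    and E: "mset (filter is_call \<pi>) = mset (filter is_call \<tau>p) + E"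
    and sum: "msum (add_mset \<sigma>c (add_mset \<sigma>l (image_mset transferred (B + E)))) = Some g"
    using sim unfolding sim_def by blast
  note h = sim_thread_history[OF sim]
  \<comment> \<open>Commands and returns need a thread that is in step: with a delayed return the
    library thread would be outside a call, against \<open>wf\<close>, and an early call is excluded
    by \<open>order\<close>.\<close>
  have level: "thread_proj ?t (lib \<pi>) = thread_proj ?t \<tau>p \<and> in_call ?t \<pi>" if "\<not> is_call \<phi>"
    using lag[of ?t]
  proof (cases rule: lag_cases)
    case level
    then show ?thesis using wf that in_call_cong by blast
  next
    case (delayed y)
    then have "\<not> in_call ?t \<tau>p" by (auto simp: in_call_def dest: is_call_not_is_ret)
    then show ?thesis using wf that by simp
  next
    case (early b)
    then have "thread_history ?t \<tau>e = thread_history ?t \<tau>p @ [b]" using h[of ?t] by simp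
    then show ?thesis using order[OF that] early(1) by blast
  qed
  show ?thesis
  proof (cases \<phi> rule: action_cases)
    case (Exec t c)
    then have "exec_step f \<phi> \<sigma>l \<sigma>l'" using step by (simp add: lib_step_def)
    from exec_step_frame[OF f this, of "add_mset \<sigma>c (image_mset transferred (B + E))" g] sum obtain g'
      where g': "exec_step f \<phi> g g'"
      "msum (add_mset \<sigma>c (add_mset \<sigma>l' (image_mset transferred (B + E)))) = Some g'"
      by (auto simp: add_mset_commute)
    have "path (global_step f) g0 (\<pi> @ [\<phi>]) g'"
      using pth g'(1) by (auto simp: path_snoc_iff global_step_def)
    moreover have "lag t' (\<tau>p @ [\<phi>]) (\<pi> @ [\<phi>])" for t'
      using lag[of t'] level Exec by (cases "t' = ?t") (auto simp: lag_def lib_snoc)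
    moreover have "client (\<pi> @ [\<phi>]) = \<tau>e" using cl level Exec by (simp add: client_snoc)
    ultimately have "sim f g0 \<sigma>c \<sigma>l' (\<tau>p @ [\<phi>]) \<tau>e (\<pi> @ [\<phi>])"
      unfolding sim_def using B E g'(2) Exec
      by (intro exI[of _ g'] exI[of _ B] exI[of _ E]) simp
    then show ?thesis ..
  next
    case (Call t m a)
    have st: "\<sigma>l \<star> transferred \<phi> = Some \<sigma>l'" using step Call by (auto simp: lib_step_def exec_step_def)
    obtain r where r: "thread_history ?t \<tau>e = thread_history ?t \<tau>p @ \<phi> # r" using ready Call by auto
    from lag[of ?t] have "thread_proj ?t (lib \<pi>) = thread_proj ?t \<tau>p @ [\<phi>]"
      by (cases rule: lag_cases) (use r h in auto)
    then have lags: "lag t' (\<tau>p @ [\<phi>]) \<pi>" for t'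
      using lag[of t'] by (cases "t' = ?t") (auto simp: lag_def)
    have "count (mset \<pi>) \<phi> > count (mset \<tau>p) \<phi>"
      using count_thread_history[of \<phi> ?t \<tau>p] count_thread_history[of \<phi> ?t \<pi>] r h Call by simp
    moreover have "count (mset \<pi>) \<phi> = count (mset \<tau>p) \<phi> + count E \<phi>"
      using arg_cong[OF E, of "\<lambda>M. count M \<phi>"] Call by simp
    ultimately have "count E \<phi> > 0" by simp
    then have "\<phi> \<in># E" by (rule count_greater_zero_iff[THEN iffD1])
    then obtain E' where E': "E = add_mset \<phi> E'" by (metis insert_DiffM)
    have "msum (add_mset \<sigma>c (add_mset \<sigma>l' (image_mset transferred (B + E')))) = Some g"
    proof -
      have "add_mset \<sigma>c (add_mset \<sigma>l (image_mset transferred (B + E))) =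
          add_mset \<sigma>l (add_mset (transferred \<phi>) (add_mset \<sigma>c (image_mset transferred (B + E'))))"
        unfolding E' by (simp add: add_mset_commute)
      then show ?thesis using sum by (simp only: msum_split[OF st] add_mset_commute[of \<sigma>c \<sigma>l'])
    qed
    then have "sim f g0 \<sigma>c \<sigma>l' (\<tau>p @ [\<phi>]) \<tau>e \<pi>"
      unfolding sim_def using pth cl B E E' Call lags
      by (intro exI[of _ g] exI[of _ B] exI[of _ E']) simp
    then show ?thesis ..
  next
    case (Ret t m a)
    have st: "\<sigma>l' \<star> transferred \<phi> = Some \<sigma>l" using step Ret by (auto simp: lib_step_def exec_step_def)
    have lags: "lag t' (\<tau>p @ [\<phi>]) \<pi>" for t'
      using lag[of t'] level Ret by (cases "t' = ?t") (auto simp: lag_def)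
    have "msum (add_mset \<sigma>c (add_mset \<sigma>l' (image_mset transferred (add_mset \<phi> B + E)))) = Some g"
    proof -
      have "add_mset \<sigma>c (add_mset \<sigma>l' (image_mset transferred (add_mset \<phi> B + E))) =
          add_mset \<sigma>l' (add_mset (transferred \<phi>) (add_mset \<sigma>c (image_mset transferred (B + E))))"
        by (simp add: add_mset_commute)
      then show ?thesis using sum by (simp only: msum_split[OF st] add_mset_commute[of \<sigma>l \<sigma>c])
    qed
    then have "sim f g0 \<sigma>c \<sigma>l' (\<tau>p @ [\<phi>]) \<tau>e \<pi>"
      unfolding sim_def using pth cl B E Ret lags
      by (intro exI[of _ g] exI[of _ "add_mset \<phi> B"] exI[of _ E]) simp
    then show ?thesis ..
  qed
qed

lemma thread_history_prefix:
  assumes "thread_history t \<tau> = xs @ a # u" "thread_history t \<tau> = ys @ v" "length xs < length ys"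
  shows "\<exists>r. ys = xs @ a # r"
  using assms by (auto simp: append_eq_append_conv2 append_eq_Cons_conv Cons_eq_append_conv)

lemma thread_history_split:
  assumes "thread_history t \<tau> = xs @ \<phi> # ys"
  shows "\<exists>\<rho> \<rho>'. \<tau> = \<rho> @ \<phi> # \<rho>' \<and> thread_history t \<rho> = xs \<and> fst \<phi> = t"
  using assms
proof (induction \<tau> arbitrary: xs)
  case (Cons \<psi> \<tau>)
  show ?case
  proof (cases "fst \<psi> = t \<and> \<not> is_exec \<psi> \<and> xs = []")
    case True
    then show ?thesis
      using Cons.prems by (intro exI[of _ "[]"] exI[of _ \<tau>]) (simp add: thread_history_Cons)
  next
    case False
    define xs' where "xs' = (if fst \<psi> = t \<and> \<not> is_exec \<psi> then tl xs else xs)"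
    have xs: "xs = (if fst \<psi> = t \<and> \<not> is_exec \<psi> then [\<psi>] else []) @ xs'"
      and "thread_history t \<tau> = xs' @ \<phi> # ys"
      using False Cons.prems by (cases xs; auto simp: thread_history_Cons xs'_def split: if_splits)+
    from Cons.IH[OF this(2)] obtain \<rho> \<rho>' where
      "\<tau> = \<rho> @ \<phi> # \<rho>'" "thread_history t \<rho> = xs'" "fst \<phi> = t" by blast
    then show ?thesis
      using xs by (intro exI[of _ "\<psi> # \<rho>"] exI[of _ \<rho>']) (simp add: thread_history_Cons)
  qed
qed simp

lemma path_Cons: "path R \<sigma> (\<phi> # \<tau>) \<sigma>'' \<longleftrightarrow> (\<exists>\<sigma>'. R \<phi> \<sigma> \<sigma>' \<and> path R \<sigma>' \<tau> \<sigma>'')"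
  using path_append[of R \<sigma> "[\<phi>]" \<tau> \<sigma>''] path_snoc_iff[of R \<sigma> "[]" \<phi>] by simp

section \<open>Merging whole runs\<close>

locale simulation =
  fixes f :: "('c, 's::separation_algebra) transformer" and g0 :: 's
    and \<tau>c \<tau>l :: "('c, 'm, 's) trace"
  assumes fp_pres: "footprint_preserving f" and local: "strongly_local f"
    and client_wf: "client_wf \<tau>c" and lib_wf: "lib_wf \<tau>l"
    and hist_le: "hist_le (history \<tau>c) (history \<tau>l)"
begin

lemma thread_history_eq: "thread_history t \<tau>c = thread_history t \<tau>l"
  using hist_le_thread_proj[OF hist_le] by (simp add: thread_proj_history)

text \<open>The last hypothesis states that all returns met in the segment are already waiting. It
  compares lengths of thread histories because both runs have the same history in each thread, so
  lengths determine which actions have been processed.\<close>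

lemma sim_client_path:
  assumes "sim f g0 \<sigma>c \<sigma>l \<tau>p \<tau>e \<pi>" "path (client_step f) \<sigma>c \<rho> \<sigma>c'"
    and "\<tau>c = \<tau>e @ \<rho> @ \<rho>'" "\<tau>l = \<tau>p @ \<tau>r"
    and "\<And>\<rho>1 y \<rho>2. \<rho> = \<rho>1 @ y # \<rho>2 \<Longrightarrow> is_ret y \<Longrightarrow>
      length (thread_history (fst y) (\<tau>e @ \<rho>1)) < length (thread_history (fst y) \<tau>p)"
  shows "\<exists>\<pi>'. sim f g0 \<sigma>c' \<sigma>l \<tau>p (\<tau>e @ \<rho>) \<pi>'"
  using assms(2,3,5)
proof (induction \<rho> arbitrary: \<sigma>c' \<rho>' rule: rev_induct)
  case Nil
  then show ?case using assms(1) by auto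
next
  case (snoc \<phi> \<rho>)
  let ?t = "fst \<phi>" and ?\<tau>e = "\<tau>e @ \<rho>"
  obtain \<sigma> where \<sigma>: "path (client_step f) \<sigma>c \<rho> \<sigma>" "client_step f \<phi> \<sigma> \<sigma>c'"
    using snoc.prems(1) by (auto simp: path_snoc_iff)
  have "\<exists>\<pi>'. sim f g0 \<sigma> \<sigma>l \<tau>p ?\<tau>e \<pi>'"
  proof (rule snoc.IH[OF \<sigma>(1), of "\<phi> # \<rho>'"])
    show "\<tau>c = \<tau>e @ \<rho> @ \<phi> # \<rho>'" using snoc.prems(2) by simp
    show "length (thread_history (fst y) (\<tau>e @ \<rho>1)) < length (thread_history (fst y) \<tau>p)"
      if "\<rho> = \<rho>1 @ y # \<rho>2" "is_ret y" for \<rho>1 y \<rho>2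
      using snoc.prems(3)[of \<rho>1 y "\<rho>2 @ [\<phi>]"] that by simp
  qed
  then obtain \<pi>' where sim: "sim f g0 \<sigma> \<sigma>l \<tau>p ?\<tau>e \<pi>'" by blast
  have split: "\<tau>c = ?\<tau>e @ \<phi> # \<rho>'" using snoc.prems(2) by simp
  then have wf: "is_ret \<phi> \<longleftrightarrow> in_call ?t ?\<tau>e" using client_wf unfolding client_wf_def by blast
  have hc: "thread_history ?t \<tau>c = thread_history ?t ?\<tau>e @ \<phi> # thread_history ?t \<rho>'" if "\<not> is_exec \<phi>"
    using split that by (simp add: thread_history_Cons)
  have hl: "thread_history ?t \<tau>c = thread_history ?t \<tau>p @ thread_history ?t \<tau>r"
    using thread_history_eq assms(4) by simp
  have "sim f g0 \<sigma>c' \<sigma>l \<tau>p (?\<tau>e @ [\<phi>]) (\<pi>' @ [\<phi>])"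
  proof (rule sim_client_step[OF fp_pres local sim \<sigma>(2) wf])
    assume "is_ret \<phi>"
    then have "length (thread_history ?t ?\<tau>e) < length (thread_history ?t \<tau>p)"
      using snoc.prems(3)[of \<rho> \<phi> "[]"] by simp
    then show "\<exists>r. thread_history ?t \<tau>p = thread_history ?t ?\<tau>e @ \<phi> # r"
      using thread_history_prefix[OF hc hl] \<open>is_ret \<phi>\<close> not_is_exec[of \<phi>] by blast
  next
    assume c: "is_call \<phi>"
    show "\<not> (\<exists>y. is_ret y \<and> thread_history ?t \<tau>p = thread_history ?t ?\<tau>e @ [y])"
    proof
      assume "\<exists>y. is_ret y \<and> thread_history ?t \<tau>p = thread_history ?t ?\<tau>e @ [y]"
      then obtain y where "is_ret y" "thread_history ?t \<tau>p = thread_history ?t ?\<tau>e @ [y]" by blast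
      \<comment> \<open>In the common history of the thread, both \<open>\<phi>\<close> and the
        delayed \<open>y\<close> directly follow the part processed by the client; a call would thus
        be a return.\<close>
      with hl hc c not_is_exec[of \<phi>] have "\<phi> = y" by simp
      then show False using c \<open>is_ret y\<close> is_call_not_is_ret by blast
    qed
  qed
  then show ?case by auto
qed

text \<open>The library trace drives the induction, with the remaining client run kept as a path so
  that it can be advanced on demand. The client moves only for a library call not yet placed, and
  once more after the library has finished.\<close>

lemma sim_lib_path:
  assumes "sim f g0 \<sigma>c \<sigma>l \<tau>p \<tau>e \<pi>" "path (client_step f) \<sigma>c \<rho>c \<sigma>c'" "path (lib_step f) \<sigma>l \<rho>l \<sigma>l'"
    and "\<tau>c = \<tau>e @ \<rho>c" "\<tau>l = \<tau>p @ \<rho>l"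
  shows "\<exists>\<pi>'. sim f g0 \<sigma>c' \<sigma>l' \<tau>l \<tau>c \<pi>'"
  using assms
proof (induction \<rho>l arbitrary: \<sigma>c \<sigma>l \<tau>p \<tau>e \<pi> \<rho>c)
  case Nil
  \<comment> \<open>The library is done and has processed the full history of every thread, so each
    return left in the client run is waiting.\<close>
  have "\<exists>\<pi>'. sim f g0 \<sigma>c' \<sigma>l \<tau>p (\<tau>e @ \<rho>c) \<pi>'"
  proof (rule sim_client_path[OF Nil(1,2), of "[]" "[]"])
    show "\<tau>c = \<tau>e @ \<rho>c @ []" "\<tau>l = \<tau>p @ []" using Nil by simp_all
    fix \<rho>1 y \<rho>2 assume "\<rho>c = \<rho>1 @ y # \<rho>2" "is_ret y"
    then have "length (thread_history (fst y) (\<tau>e @ \<rho>1)) < length (thread_history (fst y) \<tau>c)"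
      using Nil(4) not_is_exec[of y] by (simp add: thread_history_Cons)
    then show "length (thread_history (fst y) (\<tau>e @ \<rho>1)) < length (thread_history (fst y) \<tau>p)"
      using thread_history_eq Nil(5) by simp
  qed
  then show ?case using Nil by simp
next
  case (Cons \<phi> \<rho>l)
  let ?t = "fst \<phi>"
  obtain \<sigma>l1 where st: "lib_step f \<phi> \<sigma>l \<sigma>l1" and rest: "path (lib_step f) \<sigma>l1 \<rho>l \<sigma>l'"
    using Cons.prems(3) by (auto simp: path_Cons)
  have wf: "is_call \<phi> \<longleftrightarrow> \<not> in_call ?t \<tau>p" using lib_wf Cons.prems(5) unfolding lib_wf_def by blast
  \<comment> \<open>The client is advanced just far enough that a call \<open>\<phi>\<close> has
    been placed. It stays put if \<open>\<phi>\<close> is no call or was placed before.\<close>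
  have "\<exists>\<sigma>c1 \<tau>e1 \<rho>c1 \<pi>1. \<tau>c = \<tau>e1 @ \<rho>c1 \<and> path (client_step f) \<sigma>c1 \<rho>c1 \<sigma>c' \<and>
    sim f g0 \<sigma>c1 \<sigma>l \<tau>p \<tau>e1 \<pi>1 \<and>
    (is_call \<phi> \<longrightarrow> (\<exists>r. thread_history ?t \<tau>e1 = thread_history ?t \<tau>p @ \<phi> # r))"
  proof (cases "is_call \<phi> \<and> length (thread_history ?t \<tau>e) \<le> length (thread_history ?t \<tau>p)")
    case False
    have "\<exists>r. thread_history ?t \<tau>e = thread_history ?t \<tau>p @ \<phi> # r" if "is_call \<phi>"
    proof (rule thread_history_prefix[of ?t \<tau>c])
      show "thread_history ?t \<tau>c = thread_history ?t \<tau>p @ \<phi> # thread_history ?t \<rho>l"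
        using thread_history_eq Cons.prems(5) that not_is_exec[of \<phi>] by (simp add: thread_history_Cons)
      show "thread_history ?t \<tau>c = thread_history ?t \<tau>e @ thread_history ?t \<rho>c"
        using Cons.prems(4) by simp
      show "length (thread_history ?t \<tau>p) < length (thread_history ?t \<tau>e)" using False that by simp
    qed
    then show ?thesis using Cons.prems by blast
  next
    case True
    have hc: "thread_history ?t \<tau>c = thread_history ?t \<tau>p @ \<phi> # thread_history ?t \<rho>l"
      using thread_history_eq Cons.prems(5) True not_is_exec[of \<phi>] by (simp add: thread_history_Cons)
    \<comment> \<open>The same annotated action may occur several times; the matching occurrence in
      \<open>\<tau>c\<close> is the one preceded by the same history of its thread.\<close>
    from thread_history_split[OF this] obtain X Y where X: "\<tau>c = X @ \<phi> # Y"
      "thread_history ?t X = thread_history ?t \<tau>p" by blast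
    have "length \<tau>e \<le> length X"
    proof (rule ccontr)
      assume "\<not> length \<tau>e \<le> length X"
      then obtain r where "\<tau>e = X @ \<phi> # r"
        using X(1) Cons.prems(4)
        by (auto simp: append_eq_append_conv2 append_eq_Cons_conv Cons_eq_append_conv)
      then have "length (thread_history ?t \<tau>e) > length (thread_history ?t \<tau>p)"
        using X(2) True not_is_exec[of \<phi>] by (simp add: thread_history_Cons)
      then show False using True by simp
    qed
    then obtain P where P: "X = \<tau>e @ P" "\<rho>c = P @ \<phi> # Y"
      using X(1) Cons.prems(4)
      by (auto simp: append_eq_append_conv2 append_eq_Cons_conv Cons_eq_append_conv)
    have "path (client_step f) \<sigma>c ((P @ [\<phi>]) @ Y) \<sigma>c'" using Cons.prems(2) P(2) by simp
    then obtain \<sigma>c1 where c1: "path (client_step f) \<sigma>c (P @ [\<phi>]) \<sigma>c1" "path (client_step f) \<sigma>c1 Y \<sigma>c'"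
      unfolding path_append by blast
    have "\<exists>\<pi>'. sim f g0 \<sigma>c1 \<sigma>l \<tau>p (\<tau>e @ (P @ [\<phi>])) \<pi>'"
    proof (rule sim_client_path[OF Cons.prems(1) c1(1), of Y "\<phi> # \<rho>l"])
      show "\<tau>c = \<tau>e @ (P @ [\<phi>]) @ Y" using X(1) P(1) by simp
      show "\<tau>l = \<tau>p @ \<phi> # \<rho>l" by (rule Cons.prems(5))
      fix \<rho>1 y \<rho>2 assume "P @ [\<phi>] = \<rho>1 @ y # \<rho>2" "is_ret y"
      then obtain \<rho>3 where \<rho>3: "P = \<rho>1 @ y # \<rho>3"
        using True is_call_not_is_ret[of \<phi>]
        by (cases \<rho>2 rule: rev_cases) auto
      have H: "history \<tau>c = history X @ \<phi> # history Y" "history \<tau>l = history \<tau>p @ \<phi> # history \<rho>l"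
        using X(1) Cons.prems(5) True by (simp_all add: history_def)
      have HX: "history X = history (\<tau>e @ \<rho>1) @ y # history \<rho>3"
        using P(1) \<rho>3 \<open>is_ret y\<close> by (simp add: history_def)
      \<comment> \<open>The order condition of linearizability is applied here: \<open>y\<close>
        precedes the call \<open>\<phi>\<close> in the client history, so the library has processed
        \<open>y\<close> before reaching \<open>\<phi>\<close>.\<close>
      have "length (thread_proj (fst y) (history (\<tau>e @ \<rho>1))) < length (thread_proj (fst y) (history \<tau>p))"
        by (rule hist_le_ret_before_call[OF hist_le H _ refl refl _ HX \<open>is_ret y\<close>])
          (use True X(2) in \<open>simp_all add: thread_proj_history\<close>)
      then show "length (thread_history (fst y) (\<tau>e @ \<rho>1)) < length (thread_history (fst y) \<tau>p)"
        by (simp only: thread_proj_history)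
    qed
    then obtain \<pi>' where "sim f g0 \<sigma>c1 \<sigma>l \<tau>p (X @ [\<phi>]) \<pi>'" using P(1) by auto
    moreover have "\<tau>c = (X @ [\<phi>]) @ Y" using X(1) by simp
    moreover have "thread_history ?t (X @ [\<phi>]) = thread_history ?t \<tau>p @ \<phi> # []"
      using X(2) True not_is_exec[of \<phi>] by (simp add: thread_history_Cons)
    ultimately show ?thesis using c1(2) by blast
  qed
  then obtain \<sigma>c1 \<tau>e1 \<rho>c1 \<pi>1 where e1: "\<tau>c = \<tau>e1 @ \<rho>c1" "path (client_step f) \<sigma>c1 \<rho>c1 \<sigma>c'"
    "sim f g0 \<sigma>c1 \<sigma>l \<tau>p \<tau>e1 \<pi>1"
    "is_call \<phi> \<Longrightarrow> \<exists>r. thread_history ?t \<tau>e1 = thread_history ?t \<tau>p @ \<phi> # r" by blast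
  have "\<exists>\<pi>2. sim f g0 \<sigma>c1 \<sigma>l1 (\<tau>p @ [\<phi>]) \<tau>e1 \<pi>2"
  proof (rule sim_lib_step[OF fp_pres local e1(3) st wf e1(4)])
    assume nc: "\<not> is_call \<phi>"
    show "\<not> (\<exists>a. is_call a \<and> thread_history ?t \<tau>e1 = thread_history ?t \<tau>p @ [a])"
    proof
      assume "\<exists>a. is_call a \<and> thread_history ?t \<tau>e1 = thread_history ?t \<tau>p @ [a]"
      then obtain a where a: "is_call a" "thread_history ?t \<tau>e1 = thread_history ?t \<tau>p @ a # []" by auto
      from thread_history_split[OF a(2)] obtain X Y where X: "\<tau>e1 = X @ a # Y"
        "thread_history ?t X = thread_history ?t \<tau>p" "fst a = ?t" by blast
      \<comment> \<open>The library thread is inside a call, hence so is the client thread after the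
        same history; there the client discipline admits only a return, not an early call.\<close>
      then have "in_call ?t X" using in_call_cong[OF X(2)] wf nc by simp
      moreover have "\<tau>c = X @ a # (Y @ \<rho>c1)" using e1(1) X(1) by simp
      ultimately have "is_ret a" using client_wf X(3) unfolding client_wf_def by metis
      then show False using a(1) is_call_not_is_ret by blast
    qed
  qed
  then obtain \<pi>2 where "sim f g0 \<sigma>c1 \<sigma>l1 (\<tau>p @ [\<phi>]) \<tau>e1 \<pi>2" by blast
  from Cons.IH[OF this e1(2) rest e1(1)] show ?case using Cons.prems(5) by simp
qed

text \<open>Initially nothing is waiting and the global state is the sum of the two initial states.
  At the end both runs have the same history in every thread, which leaves no room for a
  lag.\<close>

lemma simulation:
  assumes "path (client_step f) \<sigma>c \<tau>c \<sigma>c'" "path (lib_step f) \<sigma>l \<tau>l \<sigma>l'" "\<sigma>c \<star> \<sigma>l = Some g0"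
  shows "\<exists>\<pi> g. path (global_step f) g0 \<pi> g \<and> client \<pi> = \<tau>c \<and>
    (\<forall>t. thread_proj t (lib \<pi>) = thread_proj t \<tau>l)"
proof -
  have "sim f g0 \<sigma>c \<sigma>l [] [] []"
    unfolding sim_def lag_def using assms(3)
    by (intro exI[of _ g0] exI[of _ "{#}"]) (simp add: msum_pair)
  from sim_lib_path[OF this assms(1,2)] obtain \<pi> where \<pi>: "sim f g0 \<sigma>c' \<sigma>l' \<tau>l \<tau>c \<pi>" by auto
  then obtain g where g: "path (global_step f) g0 \<pi> g" "client \<pi> = \<tau>c" and lag: "\<And>t. lag t \<tau>l \<pi>"
    unfolding sim_def by blast
  have "thread_proj t (lib \<pi>) = thread_proj t \<tau>l" for t
    using lag[of t] by (cases rule: lag_cases)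
      (use sim_thread_history[OF \<pi>, of t] thread_history_eq[of t] in auto)
  then show ?thesis using g by blast
qed

end

theorem theorem6p2:
  fixes f :: "('c, 's::separation_algebra) transformer"
    and \<Gamma> :: "('m, 's) spec"
    and L1 L2 :: "('c, 'm) library"
    and C :: "('c, 'm) client"
    and I1 I2 I :: "'s set"
  assumes "footprint_preserving f" and "strongly_local f"
    and "wf_spec \<Gamma>"
    and "wf_library L1" and "wf_library L2"
    and "complete_for C L1" and "complete_for C L2"
    and "safe f (SpecLib L1 \<Gamma>) I1"
    and "safe f (SpecLib L2 \<Gamma>) I2"
    and "safe f (SpecClient \<Gamma> C) I"
    and "linearized_by f \<Gamma> L1 I1 L2 I2"
  shows "safe f (Complete C L1) (I \<star>\<^sub>s I1) \<and>
    safe f (Complete C L2) (I \<star>\<^sub>s I2) \<and>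
    (\<forall>(\<sigma>1, \<tau>1) \<in> denot_from f (Complete C L1) (I \<star>\<^sub>s I1).
       \<exists>(\<sigma>2, \<tau>2) \<in> denot_from f (Complete C L2) (I \<star>\<^sub>s I2).
         client \<tau>1 = client \<tau>2)"
proof -
  interpret L1: safe_components f \<Gamma> C L1 I I1 by standard (fact assms)+
  interpret L2: safe_components f \<Gamma> C L2 I I2 by standard (fact assms)+
  have "\<exists>(\<sigma>2, \<tau>2) \<in> denot_from f (Complete C L2) (I \<star>\<^sub>s I2). client \<tau>1 = client \<tau>2"
    if den: "(\<sigma>1, \<tau>1) \<in> denot_from f (Complete C L1) (I \<star>\<^sub>s I1)" for \<sigma>1 \<tau>1
  proof -
    obtain \<sigma>1' where \<sigma>1: "\<sigma>1 \<in> I \<star>\<^sub>s I1" and tr: "\<tau>1 \<in> traces (Complete C L1)"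
      and run: "eval_run f (Complete C L1) \<sigma>1 \<tau>1 \<sigma>1' \<tau>1"
      using den unfolding mem_denot_from[OF L1.complete_safe] by (metis eval_run_Complete)
    from \<sigma>1 obtain \<sigma>c \<sigma>l where \<sigma>: "\<sigma>c \<in> I" "\<sigma>l \<in> I1" "\<sigma>c \<star> \<sigma>l = Some \<sigma>1"
      by (auto simp: sep_set_def)
    obtain \<sigma>c' \<sigma>l' \<tau>c \<tau>l where cl: "eval_run f (SpecClient \<Gamma> C) \<sigma>c (client \<tau>1) \<sigma>c' \<tau>c"
      and li: "eval_run f (SpecLib L1 \<Gamma>) \<sigma>l (lib \<tau>1) \<sigma>l' \<tau>l"
      and his: "history \<tau>c = history \<tau>l"
      using L1.decomposition[OF \<sigma> run tr] by blast
    note tr' = client_traces_decomposition[OF tr, of \<Gamma>]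
    have "(\<sigma>l, \<tau>l) \<in> denot_from f (SpecLib L1 \<Gamma>) I1"
      unfolding mem_denot_from[OF assms(8)] using \<sigma>(2) tr'(2) li by blast
    then have "(\<delta> \<sigma>l, history \<tau>l) \<in> interf f L1 \<Gamma> I1" unfolding interf_def by blast
    then obtain y where y: "y \<in> interf f L2 \<Gamma> I2" "interf_pair_le (\<delta> \<sigma>l, history \<tau>l) y"
      using assms(11) unfolding linearized_by_def interf_le_def by blast
    from y(1) obtain \<sigma>k \<tau>k where k: "(\<sigma>k, \<tau>k) \<in> denot_from f (SpecLib L2 \<Gamma>) I2"
      and y_eq: "y = (\<delta> \<sigma>k, history \<tau>k)" unfolding interf_def by blast
    have le: "\<delta> \<sigma>k \<preceq> \<delta> \<sigma>l" "hist_le (history \<tau>l) (history \<tau>k)"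
      using y(2) unfolding y_eq interf_pair_le_def by simp_all
    from k obtain \<tau>g \<sigma>k' where \<sigma>k: "\<sigma>k \<in> I2" and trk: "\<tau>g \<in> traces (SpecLib L2 \<Gamma>)"
      and runk: "eval_run f (SpecLib L2 \<Gamma>) \<sigma>k \<tau>g \<sigma>k' \<tau>k"
      unfolding mem_denot_from[OF assms(9)] by blast
    have gc: "ground \<tau>c = client \<tau>1" using eval_run_ground[OF cl] traces_ground[OF tr'(1)] by simp
    have gk: "ground \<tau>k = \<tau>g" using eval_run_ground[OF runk] traces_ground[OF trk] by simp
    \<comment> \<open>The sum is not yet known to be defined here; its definedness is derived below
      and used when the merged run is obtained.\<close>
    interpret simulation f "the (\<sigma>c \<star> \<sigma>k)" \<tau>c \<tau>k
    proof
      show "client_wf \<tau>c" by (rule client_wf_ground) (simp only: gc traces_SpecClient_wf[OF tr'(1)])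
      show "lib_wf \<tau>k" by (rule lib_wf_ground) (simp only: gk traces_SpecLib_wf[OF trk])
      show "hist_le (history \<tau>c) (history \<tau>k)" using le(2) his by simp
    qed (fact assms)+
    have "\<sigma>l \<star> \<sigma>c \<noteq> None" using \<sigma>(3) by (simp add: sep_commute)
    \<comment> \<open>The first library's initial state is compatible with the client's, and the
      second library's has a footprint no larger.\<close>
    from fp_le_defined[OF le(1) this] obtain \<sigma>2 where \<sigma>2: "\<sigma>c \<star> \<sigma>k = Some \<sigma>2"
      by (auto simp: sep_commute)
    have "\<exists>\<pi> g. path (global_step f) \<sigma>2 \<pi> g \<and> client \<pi> = \<tau>c \<and>
        (\<forall>t. thread_proj t (lib \<pi>) = thread_proj t \<tau>k)"
      using simulation[OF eval_run_SpecClient_path[OF assms(3) cl traces_ground[OF tr'(1)]]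
          eval_run_SpecLib_path[OF assms(3) runk traces_ground[OF trk]]] \<sigma>2 by simp
    then obtain \<pi> g where \<pi>: "path (global_step f) \<sigma>2 \<pi> g" "client \<pi> = \<tau>c"
        "\<And>t. thread_proj t (lib \<pi>) = thread_proj t \<tau>k" by blast
    have cl\<pi>: "client (ground \<pi>) = client \<tau>1" using \<pi>(2) gc by (simp add: client_ground)
    \<comment> \<open>The merge works with annotated actions, while trace sets hold bare ones; the
      complete program evaluates the erased trace along the same states.\<close>
    have "ground \<pi> \<in> traces (Complete C L2)"
    proof (rule client_traces_composition[OF _ trk _ assms(5,7)])
      show "client (ground \<pi>) \<in> traces (SpecClient \<Gamma> C)" using cl\<pi> tr'(1) by simp
      show "thread_proj t (lib (ground \<pi>)) = thread_proj t \<tau>g" for t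
        using \<pi>(3)[of t] by (simp add: lib_ground thread_proj_ground flip: gk)
    qed
    moreover have "\<sigma>2 \<in> I \<star>\<^sub>s I2" using \<sigma>(1) \<sigma>k \<sigma>2 by (auto simp: sep_set_def)
    ultimately have "(\<sigma>2, ground \<pi>) \<in> denot_from f (Complete C L2) (I \<star>\<^sub>s I2)"
      unfolding mem_denot_from[OF L2.complete_safe] using path_eval_run_Complete[OF \<pi>(1)] by blast
    then show ?thesis by (rule rev_bexI) (simp add: cl\<pi>)
  qed
  then show ?thesis using L1.complete_safe L2.complete_safe by blast
qed

end
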